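(* Let $M,K\subseteq\mathbb{R}$ be compact sets of positive Lebesgue measure. A linear map $$T:(L^\infty(K),\|\cdot\|_{\mathrm A})\to(L^\infty(M),\|\cdot\|_{\mathrm A})$$ is a surjective isometry if and only if there exist $\varepsilon\in\{\pm1\}$ and an increasing lipeomorphism $\psi:[0,|M|]\to[0,|K|]$ such that the map $\phi:M\to K$ given by $\phi=\sigma_K\circ\psi\circ\pi_M$ satisfies, for every $f\in L^\infty(K)$, $$J_M(Tf)=\varepsilon\,(J_Kf)\circ\phi \quad\text{on } M.$$ Equivalently (that is, for given $\varepsilon$, $\psi$ and $\phi=\sigma_K\circ\psi\circ\pi_M$, the displayed condition may be replaced by the following one), for every $f\in L^\infty(K)$ and for a.e. $y\in M$, $$(Tf)(y)=\varepsilon\,(f\circ\phi)(y)\,(\psi'\circ\pi_M)(y).$$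
   Context: $\lambda$ denotes Lebesgue measure on $\mathbb{R}$ and $|A|=\lambda(A)$. $L^\infty(K)$ is the space of (a.e. classes of) real-valued essentially bounded measurable functions on $K$. For a compact set $K\subseteq\mathbb{R}$ of positive measure (and likewise for $M$): the primitive of $f\in L^\infty(K)$ is $J_Kf(x)=\int_{[\min K,x]\cap K}f\,d\lambda$ for $x\in K$; the Alexiewicz norm is $\|f\|_{\mathrm A}=\sup_{x\in K}|J_Kf(x)|$; the measure projection is $\pi_K:K\to[0,|K|]$, $\pi_K(x)=\lambda([\min K,x]\cap K)$, which is Lipschitz, nondecreasing and surjective; the left-endpoint selector is $\sigma_K:[0,|K|]\to K$, $\sigma_K(t)=\min\pi_K^{-1}(t)=\min\{x\in K:\pi_K(x)=t\}$. A lipeomorphism is a bi-Lipschitz homeomorphism. $\psi'$ denotes the a.e.-defined derivative of $\psi$. *)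

theory Defs
  imports "HOL-Analysis.Analysis"
begin

section \<open>The space of essentially bounded functions modulo a.e. equality\<close>

text \<open>
  A function on \<open>K\<close> is represented by a function on the whole line whose values off \<open>K\<close> are
  irrelevant: everything below is relative to Lebesgue measure on \<open>K\<close>, so that two functions are
  identified as soon as they agree almost everywhere on \<open>K\<close>.
\<close>

definition ess_bounded :: "real set \<Rightarrow> (real \<Rightarrow> real) set" where
  "ess_bounded K =
     {f. f \<in> borel_measurable (lebesgue_on K) \<and> (\<exists>C. AE x in lebesgue_on K. \<bar>f x\<bar> \<le> C)}"

definition ae_eq :: "real set \<Rightarrow> ((real \<Rightarrow> real) \<times> (real \<Rightarrow> real)) set" where
  "ae_eq K = {(f, g). f \<in> ess_bounded K \<and> g \<in> ess_bounded K \<and> (AE x in lebesgue_on K. f x = g x)}"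

definition Linf :: "real set \<Rightarrow> (real \<Rightarrow> real) set set" where
  "Linf K = ess_bounded K // ae_eq K"

definition Linf_add :: "real set \<Rightarrow> (real \<Rightarrow> real) set \<Rightarrow> (real \<Rightarrow> real) set \<Rightarrow> (real \<Rightarrow> real) set" where
  "Linf_add K F G = (\<Union>f\<in>F. \<Union>g\<in>G. ae_eq K `` {\<lambda>x. f x + g x})"

definition Linf_scale :: "real set \<Rightarrow> real \<Rightarrow> (real \<Rightarrow> real) set \<Rightarrow> (real \<Rightarrow> real) set" where
  "Linf_scale K c F = (\<Union>f\<in>F. ae_eq K `` {\<lambda>x. c * f x})"

definition Linf_linear ::
    "real set \<Rightarrow> real set \<Rightarrow> ((real \<Rightarrow> real) set \<Rightarrow> (real \<Rightarrow> real) set) \<Rightarrow> bool" where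
  "Linf_linear K M T \<longleftrightarrow>
     T \<in> Linf K \<rightarrow> Linf M \<and>
     (\<forall>F\<in>Linf K. \<forall>G\<in>Linf K. T (Linf_add K F G) = Linf_add M (T F) (T G)) \<and>
     (\<forall>c. \<forall>F\<in>Linf K. T (Linf_scale K c F) = Linf_scale M c (T F))"


section \<open>Primitives and the Alexiewicz norm\<close>

text \<open>For an order, \<open>LEAST x. x \<in> K\<close> is the minimum of \<open>K\<close> whenever that minimum exists.\<close>

definition initial_part :: "real set \<Rightarrow> real \<Rightarrow> real set" where
  "initial_part K x = {(LEAST a. a \<in> K)..x} \<inter> K"

definition primitive :: "real set \<Rightarrow> (real \<Rightarrow> real) \<Rightarrow> real \<Rightarrow> real" where
  "primitive K f x = (LINT t:initial_part K x|lebesgue. f t)"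

text \<open>
  All members of a class have the same primitive (lemma \<open>Linf_primitive_class\<close> below), so the set
  passed to \<^const>\<open>the_elem\<close> is a singleton.
\<close>

definition Linf_primitive :: "real set \<Rightarrow> (real \<Rightarrow> real) set \<Rightarrow> real \<Rightarrow> real" where
  "Linf_primitive K F x = the_elem ((\<lambda>f. primitive K f x) ` F)"

definition alexiewicz_norm :: "real set \<Rightarrow> (real \<Rightarrow> real) set \<Rightarrow> real" where
  "alexiewicz_norm K F = (SUP x\<in>K. \<bar>Linf_primitive K F x\<bar>)"

definition surjective_isometry ::
    "real set \<Rightarrow> real set \<Rightarrow> ((real \<Rightarrow> real) set \<Rightarrow> (real \<Rightarrow> real) set) \<Rightarrow> bool" where
  "surjective_isometry K M T \<longleftrightarrow>
     T ` Linf K = Linf M \<and> (\<forall>F\<in>Linf K. alexiewicz_norm M (T F) = alexiewicz_norm K F)"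


section \<open>Measure projection, left-endpoint selector, lipeomorphisms\<close>

definition measure_proj :: "real set \<Rightarrow> real \<Rightarrow> real" where
  "measure_proj K x = measure lebesgue (initial_part K x)"

definition left_selector :: "real set \<Rightarrow> real \<Rightarrow> real" where
  "left_selector K t = (LEAST x. x \<in> K \<and> measure_proj K x = t)"

definition lipeomorphism :: "real set \<Rightarrow> real set \<Rightarrow> (real \<Rightarrow> real) \<Rightarrow> bool" where
  "lipeomorphism S S' \<psi> \<longleftrightarrow>
     (\<exists>\<theta>. homeomorphism S S' \<psi> \<theta> \<and>
          (\<exists>L. L-lipschitz_on S \<psi>) \<and> (\<exists>L. L-lipschitz_on S' \<theta>))"

definition increasing_lipeomorphism :: "real set \<Rightarrow> real set \<Rightarrow> (real \<Rightarrow> real) \<Rightarrow> bool" where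
  "increasing_lipeomorphism S S' \<psi> \<longleftrightarrow> lipeomorphism S S' \<psi> \<and> strict_mono_on S \<psi>"

definition transfer_map :: "real set \<Rightarrow> real set \<Rightarrow> (real \<Rightarrow> real) \<Rightarrow> real \<Rightarrow> real" where
  "transfer_map M K \<psi> = left_selector K \<circ> \<psi> \<circ> measure_proj M"

definition primitive_formula ::
    "real set \<Rightarrow> real set \<Rightarrow> ((real \<Rightarrow> real) set \<Rightarrow> (real \<Rightarrow> real) set) \<Rightarrow> real \<Rightarrow> (real \<Rightarrow> real) \<Rightarrow> bool"
where
  "primitive_formula K M T \<epsilon> \<psi> \<longleftrightarrow>
     (\<forall>F\<in>Linf K. \<forall>y\<in>M.
        Linf_primitive M (T F) y = \<epsilon> * Linf_primitive K F (transfer_map M K \<psi> y))"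

text \<open>
  The formula is required for all representatives \<open>f\<close> of the class \<open>F\<close> and \<open>g\<close> of its image.
  Where \<open>\<psi>\<close> has no derivative, and at the two endpoints of its domain, \<^const>\<open>deriv\<close> returns an
  unspecified value; the points mapped there by \<^const>\<open>measure_proj\<close> form a null set.
\<close>

definition pointwise_formula ::
    "real set \<Rightarrow> real set \<Rightarrow> ((real \<Rightarrow> real) set \<Rightarrow> (real \<Rightarrow> real) set) \<Rightarrow> real \<Rightarrow> (real \<Rightarrow> real) \<Rightarrow> bool"
where
  "pointwise_formula K M T \<epsilon> \<psi> \<longleftrightarrow>
     (\<forall>F\<in>Linf K. \<forall>f\<in>F. \<forall>g\<in>T F. AE y in lebesgue_on M.
        g y = \<epsilon> * f (transfer_map M K \<psi> y) * deriv \<psi> (measure_proj M y))"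


section \<open>Well-definedness on classes\<close>

lemma equiv_ae_eq: "equiv (ess_bounded K) (ae_eq K)"
proof (rule equivI)
  show "ae_eq K \<subseteq> ess_bounded K \<times> ess_bounded K"
    by (auto simp: ae_eq_def)
  show "refl_on (ess_bounded K) (ae_eq K)"
    by (simp add: refl_on_def ae_eq_def)
  show "sym (ae_eq K)"
    by (simp add: sym_on_def ae_eq_def eq_commute)
  show "trans (ae_eq K)"
  proof (rule transI)
    fix f g h assume "(f, g) \<in> ae_eq K" "(g, h) \<in> ae_eq K"
    moreover from this have "AE x in lebesgue_on K. f x = g x" "AE x in lebesgue_on K. g x = h x"
      by (simp_all add: ae_eq_def)
    then have "AE x in lebesgue_on K. f x = h x"
      by eventually_elim simp
    ultimately show "(f, h) \<in> ae_eq K"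
      by (simp add: ae_eq_def)
  qed
qed

lemma Linf_class: "f \<in> ess_bounded K \<Longrightarrow> ae_eq K `` {f} \<in> Linf K"
  unfolding Linf_def by (rule quotientI)

lemma class_eqI: "(f, g) \<in> ae_eq K \<Longrightarrow> ae_eq K `` {f} = ae_eq K `` {g}"
  by (rule equiv_class_eq[OF equiv_ae_eq])

lemma class_self: "f \<in> ess_bounded K \<Longrightarrow> f \<in> ae_eq K `` {f}"
  by (rule equiv_class_self[OF equiv_ae_eq])

lemma ess_bounded_add:
  assumes "f \<in> ess_bounded K" "g \<in> ess_bounded K"
  shows "(\<lambda>x. f x + g x) \<in> ess_bounded K"
proof -
  from assms obtain C D where
    "AE x in lebesgue_on K. \<bar>f x\<bar> \<le> C" "AE x in lebesgue_on K. \<bar>g x\<bar> \<le> D"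
    by (auto simp: ess_bounded_def)
  then have "AE x in lebesgue_on K. \<bar>f x + g x\<bar> \<le> C + D"
    by eventually_elim linarith
  with assms show ?thesis by (auto simp: ess_bounded_def)
qed

lemma ess_bounded_scale:
  assumes "f \<in> ess_bounded K"
  shows "(\<lambda>x. c * f x) \<in> ess_bounded K"
proof -
  from assms obtain C where "AE x in lebesgue_on K. \<bar>f x\<bar> \<le> C"
    by (auto simp: ess_bounded_def)
  then have "AE x in lebesgue_on K. \<bar>c * f x\<bar> \<le> \<bar>c\<bar> * C"
    by eventually_elim (simp add: abs_mult mult_left_mono)
  with assms show ?thesis by (auto simp: ess_bounded_def)
qed

lemma Linf_add_class:
  assumes "f \<in> ess_bounded K" "g \<in> ess_bounded K"
  shows "Linf_add K (ae_eq K `` {f}) (ae_eq K `` {g}) = ae_eq K `` {\<lambda>x. f x + g x}"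
proof -
  have "ae_eq K `` {\<lambda>x. f' x + g' x} = ae_eq K `` {\<lambda>x. f x + g x}"
    if "f' \<in> ae_eq K `` {f}" "g' \<in> ae_eq K `` {g}" for f' g'
  proof (rule class_eqI)
    have "AE x in lebesgue_on K. f x = f' x" "AE x in lebesgue_on K. g x = g' x"
      using that by (auto simp: ae_eq_def)
    then have "AE x in lebesgue_on K. f' x + g' x = f x + g x"
      by eventually_elim simp
    with that show "(\<lambda>x. f' x + g' x, \<lambda>x. f x + g x) \<in> ae_eq K"
      by (auto simp: ae_eq_def intro!: ess_bounded_add)
  qed
  then show ?thesis
    unfolding Linf_add_def using assms[THEN class_self] by blast
qed

lemma Linf_scale_class:
  assumes "f \<in> ess_bounded K"
  shows "Linf_scale K c (ae_eq K `` {f}) = ae_eq K `` {\<lambda>x. c * f x}"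
proof -
  have "ae_eq K `` {\<lambda>x. c * f' x} = ae_eq K `` {\<lambda>x. c * f x}" if "f' \<in> ae_eq K `` {f}" for f'
  proof (rule class_eqI)
    have "AE x in lebesgue_on K. f x = f' x"
      using that by (auto simp: ae_eq_def)
    then have "AE x in lebesgue_on K. c * f' x = c * f x"
      by eventually_elim simp
    with that show "(\<lambda>x. c * f' x, \<lambda>x. c * f x) \<in> ae_eq K"
      by (auto simp: ae_eq_def intro!: ess_bounded_scale)
  qed
  then show ?thesis
    unfolding Linf_scale_def using assms[THEN class_self] by blast
qed

lemma primitive_cong:
  assumes K: "compact K" and fg: "(f, g) \<in> ae_eq K"
  shows "primitive K f x = primitive K g x"
proof -
  have [measurable]: "K \<in> sets lebesgue"
    using K by (simp add: lmeasurable_compact fmeasurableD)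
  have sub: "initial_part K x \<subseteq> K" and [measurable]: "initial_part K x \<in> sets lebesgue"
    by (auto simp: initial_part_def)
  have "AE t in lebesgue. t \<in> K \<longrightarrow> f t = g t"
    using fg by (auto simp: ae_eq_def AE_restrict_space_iff)
  then have ae: "AE t in lebesgue. t \<in> initial_part K x \<longrightarrow> f t = g t"
    by eventually_elim (use sub in auto)
  have "set_borel_measurable lebesgue (initial_part K x) h" if "h \<in> ess_bounded K" for h
  proof -
    have "h \<in> borel_measurable (lebesgue_on (initial_part K x))"
      using that measurable_restrict_mono[OF _ sub] by (auto simp: ess_bounded_def)
    then show ?thesis
      by (simp add: set_borel_measurable_def borel_measurable_restrict_space_iff)
  qed
  with fg have meas:
    "(\<lambda>t. indicator (initial_part K x) t *\<^sub>R f t) \<in> borel_measurable lebesgue"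
    "(\<lambda>t. indicator (initial_part K x) t *\<^sub>R g t) \<in> borel_measurable lebesgue"
    by (simp_all add: ae_eq_def set_borel_measurable_def)
  have "AE t in lebesgue. indicator (initial_part K x) t *\<^sub>R f t = indicator (initial_part K x) t *\<^sub>R g t"
    using ae by eventually_elim (simp add: indicator_def)
  then show ?thesis
    unfolding primitive_def set_lebesgue_integral_def by (rule integral_cong_AE[OF meas])
qed

lemma Linf_primitive_class:
  assumes "compact K" "f \<in> ess_bounded K"
  shows "Linf_primitive K (ae_eq K `` {f}) x = primitive K f x"
proof -
  have "primitive K g x = primitive K f x" if "g \<in> ae_eq K `` {f}" for g
    using primitive_cong[OF assms(1), of f g x] that by simp
  then have "(\<lambda>g. primitive K g x) ` (ae_eq K `` {f}) = {primitive K f x}"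
    using class_self[OF assms(2)] by blast
  then show ?thesis by (simp add: Linf_primitive_def)
qed

end

theory Submission
  imports Defs
begin

text \<open>
  Write \<open>a = |K|\<close> and \<open>m = |M|\<close>. Every primitive factors through the measure projection: it is
  \<open>F \<circ> measure_proj K\<close> for a Lipschitz function \<open>F\<close> on \<open>[0, a]\<close> with \<open>F 0 = 0\<close>, and
  the Alexiewicz norm of the class is the supremum norm of \<open>F\<close>. Conversely every such \<open>F\<close>
  arises from exactly one class. So \<open>Linf K\<close> with the Alexiewicz norm is the space \<open>Lip0 a\<close> of
  Lipschitz functions vanishing at \<open>0\<close> with the supremum norm, and the theorem becomes a
  Banach--Stone theorem for \<open>Lip0\<close>.

  That theorem (\<open>banach_stone\<close>) is proved by following peak functions. The functions of norm at
  most \<open>1\<close> whose image takes the value \<open>1\<close> at a given \<open>t\<close> form a convex set in the unit sphere, so by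
  compactness all of them attain the value \<open>1\<close>, or all of them the value \<open>-1\<close>, at one common
  point \<open>u\<close>. Doing the same for the inverse
  isometry and testing with tent functions shows that peaks at \<open>u\<close> correspond exactly to peaks at
  \<open>t\<close>. Adding a tall tent to a Lipschitz function makes it peak at \<open>u\<close>, so the value of
  every function at \<open>u\<close> determines the value of its image at \<open>t\<close> up to a sign. The
  image of the identity then is \<open>\<epsilon> * \<psi>\<close>, which makes the sign constant and \<open>\<psi>\<close> Lipschitz; the
  inverse isometry gives the same for the inverse of \<open>\<psi>\<close>.

  The description of \<open>Lip0 a\<close> and the pointwise formula rest on two facts about the real line.
  The indefinite integral of a bounded measurable function has that function as its derivative
  almost everywhere (\<open>lebesgue_differentiation\<close>, from the Vitali covering theorem), and every
  Lipschitz function is the indefinite integral of a bounded function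
  (\<open>lipschitz_indefinite_integral\<close>, from the Radon--Nikodym theorem). The first one gives
  uniqueness of the class with a given primitive, the second one existence. Together they say that
  Lipschitz functions are differentiable almost everywhere, and the pointwise formula is then the
  chain rule for \<open>\<epsilon> * (F \<circ> \<psi> \<circ> measure_proj M)\<close>, because a measure projection has derivative
  \<open>1\<close> at almost every point of its set and pulls null sets back to null sets.
\<close>

section \<open>Differentiation of indefinite integrals\<close>

text \<open>
  By Vitali's theorem countably many disjoint ones of the given intervals cover \<open>E\<close> up to a null
  set, and they can be chosen inside \<open>U\<close>; summing the inequalities over them gives the claim.
\<close>

lemma Vitali_growth:
  fixes \<mu> :: "real measure"
  assumes sets: "sets \<mu> = sets lebesgue" and E: "E \<in> sets lebesgue" and U: "open U" "E \<subseteq> U"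
    and cover: "\<And>x d. x \<in> E \<Longrightarrow> 0 < d \<Longrightarrow>
      \<exists>a b. a < b \<and> a \<le> x \<and> x \<le> b \<and> b - a < d \<and> q * ennreal (b - a) \<le> emeasure \<mu> {a..b}"
  shows "q * emeasure lebesgue E \<le> emeasure \<mu> U"
proof -
  define I where "I = {(a, b). a < b \<and> {a..b} \<subseteq> U \<and> q * ennreal (b - a) \<le> emeasure \<mu> {a..b}}"
  define c :: "real \<times> real \<Rightarrow> real" where "c = (\<lambda>(a, b). (a + b) / 2)"
  define r :: "real \<times> real \<Rightarrow> real" where "r = (\<lambda>(a, b). (b - a) / 2)"
  have cb: "cball (c i) (r i) = {fst i..snd i}" if "i \<in> I" for i
    using that by (cases i) (auto simp: c_def r_def I_def cball_eq_atLeastAtMost field_simps)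
  have S: "\<exists>i. i \<in> I \<and> x \<in> cball (c i) (r i) \<and> r i < d" if "x \<in> E" "0 < d" for x d
  proof -
    obtain e where e: "e > 0" "ball x e \<subseteq> U"
      using U \<open>x \<in> E\<close> by (meson open_contains_ball subsetD)
    obtain a b where ab: "a < b" "a \<le> x" "x \<le> b" "b - a < min d e"
      "q * ennreal (b - a) \<le> emeasure \<mu> {a..b}"
      using cover[OF \<open>x \<in> E\<close>, of "min d e"] \<open>0 < d\<close> e by auto
    have "{a..b} \<subseteq> ball x e"
      using ab by (auto simp: dist_real_def)
    with e ab have "(a, b) \<in> I" by (auto simp: I_def)
    moreover have "x \<in> cball (c (a, b)) (r (a, b))"
      using cb[OF calculation] ab by auto
    moreover have "r (a, b) < d"
      using ab by (auto simp: r_def)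
    ultimately show ?thesis by blast
  qed
  have r0: "0 < r i" if "i \<in> I" for i
    using that by (auto simp: I_def r_def)
  obtain C where C: "countable C" "C \<subseteq> I"
     "pairwise (\<lambda>i j. disjnt (cball (c i) (r i)) (cball (c j) (r j))) C"
     "negligible (E - (\<Union>i \<in> C. cball (c i) (r i)))"
    by (rule Vitali_covering_theorem_cballs[of I r E c, OF r0 S])
  define J where "J = (\<lambda>i::real \<times> real. {fst i..snd i})"
  have cJ: "cball (c i) (r i) = J i" if "i \<in> C" for i
    using cb[OF subsetD[OF C(2) that]] by (simp add: J_def)
  have disj: "disjoint_family_on J C"
    using C(3) cJ by (auto simp: disjoint_family_on_def pairwise_def disjnt_def)
  have neg: "negligible (E - (\<Union>i\<in>C. J i))"
    using C(4) cJ by simp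
  have [measurable]: "J i \<in> sets lebesgue" for i by (simp add: J_def)
  have [measurable]: "(\<Union>i\<in>C. J i) \<in> sets lebesgue"
    using C(1) by auto
  have "emeasure lebesgue E \<le> emeasure lebesgue ((\<Union>i\<in>C. J i) \<union> (E - (\<Union>i\<in>C. J i)))"
    using E by (intro emeasure_mono) auto
  also have "\<dots> = emeasure lebesgue (\<Union>i\<in>C. J i)"
    using neg by (intro emeasure_Un_null_set) (auto simp: negligible_iff_null_sets)
  also have "\<dots> = (\<integral>\<^sup>+i. emeasure lebesgue (J i) \<partial>count_space C)"
    using C(1) disj by (intro emeasure_UN_countable) auto
  finally have "q * emeasure lebesgue E \<le> q * (\<integral>\<^sup>+i. emeasure lebesgue (J i) \<partial>count_space C)"
    by (intro mult_left_mono) auto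
  also have "\<dots> = (\<integral>\<^sup>+i. q * emeasure lebesgue (J i) \<partial>count_space C)"
    by (subst nn_integral_cmult) auto
  also have "\<dots> \<le> (\<integral>\<^sup>+i. emeasure \<mu> (J i) \<partial>count_space C)"
    using C(2) by (intro nn_integral_mono) (auto simp: I_def J_def)
  also have "\<dots> = emeasure \<mu> (\<Union>i\<in>C. J i)"
    using C(1) disj by (intro emeasure_UN_countable[symmetric]) (auto simp: sets)
  also have "\<dots> \<le> emeasure \<mu> U"
    using C(2) U(1) by (intro emeasure_mono) (fastforce simp: sets J_def I_def)+
  finally show ?thesis .
qed

text \<open>
  The differentiation theorem in a nutshell: on the exceptional set \<open>E\<close> the density is below \<open>p\<close>,
  although arbitrarily short intervals around each point have mean density at least \<open>q\<close>. For an
  open \<open>U\<close> slightly larger than a bounded part of \<open>E\<close>, the covering lemma bounds \<open>\<mu> U\<close> from below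
  by \<open>q |E|\<close>, while the density bounds it from above by \<open>p |E| + C |U - E|\<close>. The intervals are
  taken around \<open>x\<close> in the strict sense because this makes \<open>E\<close> measurable: up to the condition on
  \<open>h\<close> it is a countable intersection of unions of open intervals.
\<close>

lemma negligible_density_gap:
  fixes h :: "real \<Rightarrow> real"
  assumes h [measurable]: "h \<in> borel_measurable lebesgue" and h0: "\<And>x. 0 \<le> h x" and hC: "\<And>x. h x \<le> C"
    and pq: "0 \<le> p" "p < q"
  defines "\<mu> \<equiv> density lebesgue (\<lambda>x. ennreal (h x))"
  shows "negligible {x. h x < p \<and> (\<forall>d>0. \<exists>a b. a < x \<and> x < b \<and> b - a < d \<and>
           ennreal (q * (b - a)) \<le> emeasure \<mu> {a..b})}" (is "negligible ?E")
proof -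
  define V where "V = (\<lambda>d. \<Union>(a, b)\<in>{(a, b). b - a < d \<and> ennreal (q * (b - a)) \<le> emeasure \<mu> {a..b}}. {a<..<b})"
  have E_eq: "?E = {x. h x < p} \<inter> (\<Inter>n. V (1 / real (Suc n)))" (is "_ = ?E'")
  proof (rule set_eqI)
    fix x
    have V: "x \<in> V d \<longleftrightarrow> (\<exists>a b. a < x \<and> x < b \<and> b - a < d \<and> ennreal (q * (b - a)) \<le> emeasure \<mu> {a..b})" for d
      by (auto simp: V_def)
    have mono: "x \<in> V d'" if "x \<in> V d" "d \<le> d'" for d d'
      using that unfolding V by (meson less_le_trans)
    have "(\<forall>d>0. x \<in> V d) \<longleftrightarrow> (\<forall>n. x \<in> V (1 / real (Suc n)))"
    proof safe
      fix d :: real assume "0 < d" and *: "\<forall>n. x \<in> V (1 / real (Suc n))"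
      obtain n where "1 / real (Suc n) < d" using nat_approx_posE[OF \<open>0 < d\<close>] .
      with * mono[of "1 / real (Suc n)" d] show "x \<in> V d" by simp
    qed (auto simp: V)
    then show "x \<in> ?E \<longleftrightarrow> x \<in> ?E'" by (simp only: V[symmetric] mem_Collect_eq Int_iff INT_iff) blast
  qed
  have "open (V d)" for d by (auto simp: V_def)
  then have [measurable]: "V d \<in> sets lebesgue" for d by auto
  have Emeas: "?E \<in> sets lebesgue" 
    unfolding E_eq by measurable
  define E where "E = ?E"
  note Emeas [folded E_def, measurable]
  have E_less: "h x < p" if "x \<in> E" for x using that by (simp add: E_def)
  have "negligible (E \<inter> {-real n..real n})" for n
  proof -
    let ?F = "E \<inter> {-real n..real n}"
    have F: "?F \<in> lmeasurable"
      using fmeasurable_Int_fmeasurable[OF bounded_set_imp_lmeasurable, of "{-real n..real n}" E]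
      by (simp add: Int_commute)
    have [measurable]: "?F \<in> sets lebesgue" using F by (rule fmeasurableD)
    have key: "(q - p) * measure lebesgue ?F \<le> C * e" if "0 < e" for e
    proof -
      obtain U where U: "open U" "?F \<subseteq> U" "U - ?F \<in> lmeasurable" "emeasure lebesgue (U - ?F) < ennreal e"
        using sets_lebesgue_outer_open[of ?F e] \<open>0 < e\<close> by auto
      have [measurable]: "U \<in> sets lebesgue" using U(1) by auto
      have "0 \<le> C" using h0[of 0] hC[of 0] by linarith
      have "ennreal q * emeasure lebesgue ?F \<le> emeasure \<mu> U"
      proof (rule Vitali_growth)
        fix x d :: real assume "x \<in> ?F" "0 < d"
        then have "\<exists>a b. a < x \<and> x < b \<and> b - a < d \<and> ennreal (q * (b - a)) \<le> emeasure \<mu> {a..b}"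
            by (simp add: E_def)
          then obtain a b where "a < x" "x < b" "b - a < d" "ennreal (q * (b - a)) \<le> emeasure \<mu> {a..b}"
            by blast
          then show "\<exists>a b. a < b \<and> a \<le> x \<and> x \<le> b \<and> b - a < d \<and> ennreal q * ennreal (b - a) \<le> emeasure \<mu> {a..b}"
            using pq by (intro exI[of _ a] exI[of _ b]) (auto simp: ennreal_mult)
      qed (simp_all add: \<mu>_def U(1,2))
      also have "emeasure \<mu> U = emeasure \<mu> (?F \<union> (U - ?F))"
        using U by (intro arg_cong[where f="emeasure \<mu>"]) auto
      also have "\<dots> = emeasure \<mu> ?F + emeasure \<mu> (U - ?F)"
        by (intro plus_emeasure[symmetric]) (auto simp: \<mu>_def)
      also have "emeasure \<mu> ?F \<le> ennreal p * emeasure lebesgue ?F"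
      proof -
        have "emeasure \<mu> ?F = (\<integral>\<^sup>+x. ennreal (h x) * indicator ?F x \<partial>lebesgue)"
          unfolding \<mu>_def by (rule emeasure_density) auto
        also have "\<dots> \<le> (\<integral>\<^sup>+x. ennreal p * indicator ?F x \<partial>lebesgue)"
          by (intro nn_integral_mono) (auto simp: indicator_def intro!: ennreal_leI dest: E_less)
        finally show ?thesis by (simp add: nn_integral_cmult_indicator)
      qed
      also have "emeasure \<mu> (U - ?F) \<le> ennreal C * emeasure lebesgue (U - ?F)"
      proof -
        have "emeasure \<mu> (U - ?F) = (\<integral>\<^sup>+x. ennreal (h x) * indicator (U - ?F) x \<partial>lebesgue)"
          unfolding \<mu>_def by (rule emeasure_density) auto
        also have "\<dots> \<le> (\<integral>\<^sup>+x. ennreal C * indicator (U - ?F) x \<partial>lebesgue)"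
          by (intro nn_integral_mono) (auto simp: indicator_def hC intro: ennreal_leI)
        finally show ?thesis by (simp add: nn_integral_cmult_indicator)
      qed
      also have "ennreal C * emeasure lebesgue (U - ?F) \<le> ennreal C * ennreal e"
        using U(4) by (intro mult_left_mono) auto
      finally have "ennreal q * emeasure lebesgue ?F \<le> ennreal p * emeasure lebesgue ?F + ennreal C * ennreal e"
        by (simp add: add_left_mono add_right_mono)
      then have "ennreal (q * measure lebesgue ?F) \<le> ennreal (p * measure lebesgue ?F + C * e)"
        using pq \<open>0 \<le> C\<close> \<open>0 < e\<close> F
        by (simp add: emeasure_eq_measure2 ennreal_mult)
      then show ?thesis
        using pq \<open>0 \<le> C\<close> \<open>0 < e\<close> by (subst (asm) ennreal_le_iff) (auto simp: algebra_simps)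
    qed
    have "(q - p) * measure lebesgue ?F \<le> 0"
    proof (rule field_le_epsilon)
      fix e :: real assume "0 < e"
      have "0 \<le> C" using h0[of 0] hC[of 0] by linarith
      then have "C * (e / (C + 1)) \<le> e" using \<open>0 < e\<close> by (simp add: field_simps)
      moreover have "(q - p) * measure lebesgue ?F \<le> C * (e / (C + 1))"
        using key[of "e / (C + 1)"] \<open>0 < e\<close> \<open>0 \<le> C\<close> by simp
      ultimately show "(q - p) * measure lebesgue ?F \<le> 0 + e" by linarith
    qed
    then have "measure lebesgue ?F = 0"
      using pq measure_nonneg[of lebesgue ?F] by (smt (verit) mult_pos_pos)
    with F show ?thesis by (simp add: negligible_iff_measure)
  qed
  then have "negligible (\<Union>n. E \<inter> {-real n..real n})"
    by (intro negligible_countable_Union) auto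
  moreover have "E \<subseteq> (\<Union>n. E \<inter> {-real n..real n})"
  proof
    fix x assume "x \<in> E"
    moreover obtain n where "\<bar>x\<bar> \<le> real n" using real_arch_simple by blast
    ultimately have "x \<in> E \<inter> {-real n..real n}" by (simp add: abs_le_iff minus_le_iff)
    then show "x \<in> (\<Union>n. E \<inter> {-real n..real n})" by blast
  qed
  ultimately show ?thesis unfolding E_def[symmetric] by (rule negligible_subset)
qed

lemma set_integrable_bounded_interval:
  fixes h :: "real \<Rightarrow> real"
  assumes [measurable]: "h \<in> borel_measurable lebesgue" and hC: "\<And>x. \<bar>h x\<bar> \<le> C"
  shows "set_integrable lebesgue {a<..b} h"
  unfolding set_integrable_def
proof (rule Bochner_Integration.integrable_bound)
  have "emeasure lebesgue {a<..b} < \<infinity>"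
    by (cases "a \<le> b") auto
  then show "integrable lebesgue (\<lambda>t. C * indicator {a<..b} t :: real)"
    by (intro integrable_mult_right integrable_real_indicator) auto
  show "AE t in lebesgue. norm (indicator {a<..b} t *\<^sub>R h t) \<le> norm (C * indicator {a<..b} t)"
    using hC by (auto simp: indicator_def intro: order_trans[OF hC] abs_ge_self)
  show "(\<lambda>t. indicator {a<..b} t *\<^sub>R h t) \<in> borel_measurable lebesgue"
    by (intro borel_measurable_scaleR borel_measurable_indicator) auto
qed

lemma emeasure_density_interval:
  fixes h :: "real \<Rightarrow> real"
  assumes h [measurable]: "h \<in> borel_measurable lebesgue" and h0: "\<And>x. 0 \<le> h x" and hC: "\<And>x. h x \<le> C"
  shows "emeasure (density lebesgue (\<lambda>x. ennreal (h x))) {a..b} = ennreal (LINT t:{a<..b}|lebesgue. h t)"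
proof -
  have int: "set_integrable lebesgue {a<..b} h"
    using h0 hC by (intro set_integrable_bounded_interval[of h C]) auto
  have "emeasure (density lebesgue (\<lambda>x. ennreal (h x))) {a..b} = (\<integral>\<^sup>+x. ennreal (h x) * indicator {a..b} x \<partial>lebesgue)"
    by (rule emeasure_density) auto
  also have "\<dots> = (\<integral>\<^sup>+x. ennreal (indicator {a<..b} x *\<^sub>R h x) \<partial>lebesgue)"
  proof (rule nn_integral_cong_AE)
    have "AE x in lebesgue. x \<noteq> a"
      using AE_not_in[of "{a}" lebesgue] by (simp add: null_sets_completionI)
    then show "AE x in lebesgue. ennreal (h x) * indicator {a..b} x = ennreal (indicator {a<..b} x *\<^sub>R h x)"
      by eventually_elim (auto simp: indicator_def)
  qed
  also have "\<dots> = ennreal (LINT t:{a<..b}|lebesgue. h t)"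
    unfolding set_lebesgue_integral_def
    using int h0 by (intro nn_integral_eq_integral) (auto simp: set_integrable_def)
  finally show ?thesis .
qed

text \<open>
  The density \<open>h + C\<close> is nonnegative, so the previous lemma applies to it; if the upper slope at \<open>x\<close>
  exceeds \<open>h x\<close>, then rational numbers \<open>p < q\<close> fit between the two.
\<close>

lemma lebesgue_upper_slope:
  fixes h H :: "real \<Rightarrow> real"
  assumes h [measurable]: "h \<in> borel_measurable lebesgue" and hC: "\<And>x. \<bar>h x\<bar> \<le> C"
    and H: "\<And>x y. x \<le> y \<Longrightarrow> H y - H x = (LINT t:{x<..y}|lebesgue. h t)"
  shows "AE x in lebesgue. \<forall>\<eta>>0. \<exists>d>0. \<forall>a b. a < x \<longrightarrow> x < b \<longrightarrow> b - a < d \<longrightarrow> H b - H a \<le> (h x + \<eta>) * (b - a)"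
proof -
  have C0: "0 \<le> C" using hC[of 0] by linarith
  define k where "k = (\<lambda>x. h x + C)"
  have [measurable]: "k \<in> borel_measurable lebesgue" by (simp add: k_def)
  have k0: "0 \<le> k x" and kC: "k x \<le> 2 * C" for x using hC[of x] by (auto simp: k_def)
  define \<mu> where "\<mu> = density lebesgue (\<lambda>x. ennreal (k x))"
  have \<mu>: "emeasure \<mu> {a..b} = ennreal (H b - H a + C * (b - a))" if "a \<le> b" for a b
  proof -
    have "emeasure \<mu> {a..b} = ennreal (LINT t:{a<..b}|lebesgue. k t)"
      unfolding \<mu>_def using k0 kC by (intro emeasure_density_interval) auto
    also have "(LINT t:{a<..b}|lebesgue. k t) = (LINT t:{a<..b}|lebesgue. h t) + (LINT t:{a<..b}|lebesgue. C)"
      unfolding k_def using hC C0 by (intro set_integral_add set_integrable_bounded_interval) auto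
    also have "(LINT t:{a<..b}|lebesgue. C) = C * (b - a)"
      using that by (simp add: set_lebesgue_integral_def)
    finally show ?thesis using H[OF that] by simp
  qed
  have "AE x in lebesgue. \<forall>p\<in>\<rat>. \<forall>q\<in>\<rat>. 0 \<le> p \<longrightarrow> p < q \<longrightarrow> \<not> (k x < p \<and> (\<forall>d>0. \<exists>a b. a < x \<and> x < b \<and> b - a < d \<and>
           ennreal (q * (b - a)) \<le> emeasure \<mu> {a..b}))"
  proof (intro AE_ball_countable' countable_rat)
    fix p q :: real assume "p \<in> \<rat>" "q \<in> \<rat>"
    show "AE x in lebesgue. 0 \<le> p \<longrightarrow> p < q \<longrightarrow> \<not> (k x < p \<and> (\<forall>d>0. \<exists>a b. a < x \<and> x < b \<and> b - a < d \<and>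
           ennreal (q * (b - a)) \<le> emeasure \<mu> {a..b}))"
    proof (cases "0 \<le> p \<and> p < q")
      case True
      then have "negligible {x. k x < p \<and> (\<forall>d>0. \<exists>a b. a < x \<and> x < b \<and> b - a < d \<and>
           ennreal (q * (b - a)) \<le> emeasure \<mu> {a..b})}"
        unfolding \<mu>_def using k0 kC by (intro negligible_density_gap[where C="2*C"]) auto
      from AE_not_in[OF this[unfolded negligible_iff_null_sets]] show ?thesis
        by eventually_elim (simp only: mem_Collect_eq, blast)
    qed auto
  qed
  then show ?thesis
  proof eventually_elim
    case (elim x)
    show ?case
    proof (intro allI impI)
      fix \<eta> :: real assume "0 < \<eta>"
      obtain p where p: "p \<in> \<rat>" "k x < p" "p < k x + \<eta>"
        using Rats_dense_in_real[of "k x" "k x + \<eta>"] \<open>0 < \<eta>\<close> by auto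
      obtain q where q: "q \<in> \<rat>" "p < q" "q < k x + \<eta>"
        using Rats_dense_in_real[of p "k x + \<eta>"] p by auto
      have "0 \<le> p" using k0[of x] p by linarith
      with elim p q obtain d where d: "0 < d" "\<And>a b. a < x \<Longrightarrow> x < b \<Longrightarrow> b - a < d \<Longrightarrow>
          \<not> ennreal (q * (b - a)) \<le> emeasure \<mu> {a..b}"
        by blast
      have "H b - H a \<le> (h x + \<eta>) * (b - a)" if ab: "a < x" "x < b" "b - a < d" for a b
      proof -
        have "ennreal (H b - H a + C * (b - a)) < ennreal (q * (b - a))"
          using d(2)[OF ab] \<mu>[of a b] ab by (simp add: not_le)
        moreover have "0 \<le> q * (b - a)" using \<open>0 \<le> p\<close> q ab by simp
        ultimately have "H b - H a + C * (b - a) < q * (b - a)"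
          by (metis ennreal_leI not_le)
        also have "q * (b - a) \<le> (k x + \<eta>) * (b - a)"
          using q ab by (intro mult_right_mono) auto
        finally show ?thesis by (simp add: k_def algebra_simps)
      qed
      with d(1) show "\<exists>d>0. \<forall>a b. a < x \<longrightarrow> x < b \<longrightarrow> b - a < d \<longrightarrow> H b - H a \<le> (h x + \<eta>) * (b - a)"
        by blast
    qed
  qed
qed

text \<open>
  Slopes over intervals with \<open>x\<close> in the interior control difference quotients at \<open>x\<close> itself, by
  letting one endpoint tend to \<open>x\<close>.
\<close>

lemma slope_bound_endpoints:
  fixes H :: "real \<Rightarrow> real"
  assumes cont: "continuous_on UNIV H"
    and slope: "\<And>a b. a < x \<Longrightarrow> x < b \<Longrightarrow> b - a < d \<Longrightarrow> H b - H a \<le> c * (b - a)"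
    and y: "y \<noteq> x" "\<bar>y - x\<bar> < d"
  shows "(H y - H x) / (y - x) \<le> c"
proof (cases "x < y")
  case True
  have "H y - H x \<le> c * (y - x)"
  proof (rule tendsto_le)
    show "((\<lambda>a. H y - H a) \<longlongrightarrow> H y - H x) (at_left x)" "((\<lambda>a. c * (y - a)) \<longlongrightarrow> c * (y - x)) (at_left x)"
      using cont by (auto intro!: tendsto_intros simp: continuous_on_def intro: tendsto_within_subset)
    have "\<forall>\<^sub>F a in at_left x. y - d < a \<and> a < x"
      using True y by (auto simp: eventually_at_left_field intro!: exI[of _ "y - d"])
    then show "\<forall>\<^sub>F a in at_left x. H y - H a \<le> c * (y - a)"
      by eventually_elim (use slope[of _ y] True in auto)
  qed simp
  with True show ?thesis by (simp add: field_simps)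
next
  case False
  with y have "y < x" by simp
  have "H x - H y \<le> c * (x - y)"
  proof (rule tendsto_le)
    show "((\<lambda>b. H b - H y) \<longlongrightarrow> H x - H y) (at_right x)" "((\<lambda>b. c * (b - y)) \<longlongrightarrow> c * (x - y)) (at_right x)"
      using cont by (auto intro!: tendsto_intros simp: continuous_on_def intro: tendsto_within_subset)
    have "\<forall>\<^sub>F b in at_right x. x < b \<and> b < y + d"
      using \<open>y < x\<close> y by (auto simp: eventually_at_right_field intro!: exI[of _ "y + d"])
    then show "\<forall>\<^sub>F b in at_right x. H b - H y \<le> c * (b - y)"
      by eventually_elim (use slope[of y] \<open>y < x\<close> in auto)
  qed simp
  with \<open>y < x\<close> show ?thesis by (simp add: field_simps)
qed

text \<open>
  The bound on upper slopes, applied to \<open>h\<close> and to \<open>-h\<close>, squeezes the difference quotients. The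
  primitive is described by its increments so that the result also applies to a Lipschitz function
  that is given first.
\<close>

theorem lebesgue_differentiation:
  fixes h H :: "real \<Rightarrow> real"
  assumes h [measurable]: "h \<in> borel_measurable lebesgue" and hC: "AE x in lebesgue. \<bar>h x\<bar> \<le> C"
    and H: "\<And>x y. x \<le> y \<Longrightarrow> H y - H x = (LINT t:{x<..y}|lebesgue. h t)"
  shows "AE x in lebesgue. (H has_real_derivative h x) (at x)"
proof -
  \<comment> \<open>truncating \<open>h\<close> replaces the almost everywhere bound by a bound everywhere\<close>
  define D where "D = max C 0"
  define k where "k = (\<lambda>x. max (- D) (min D (h x)))"
  have [measurable]: "k \<in> borel_measurable lebesgue" by (simp add: k_def)
  have kD: "\<bar>k x\<bar> \<le> D" for x by (auto simp: k_def D_def)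
  have hk: "AE x in lebesgue. h x = k x"
    using hC by eventually_elim (auto simp: k_def D_def)
  have Hk: "H y - H x = (LINT t:{x<..y}|lebesgue. k t)" if "x \<le> y" for x y
    unfolding H[OF that] set_lebesgue_integral_def
    using hk by (intro integral_cong_AE borel_measurable_scaleR borel_measurable_indicator) (auto elim: eventually_mono)
  have int: "\<bar>LINT t:{x<..y}|lebesgue. k t\<bar> \<le> D * (y - x)" if "x \<le> y" for x y
  proof -
    have "\<bar>LINT t:{x<..y}|lebesgue. k t\<bar> \<le> (LINT t:{x<..y}|lebesgue. D)"
      unfolding set_lebesgue_integral_def
    proof (rule integral_abs_bound_integral)
      show "integrable lebesgue (\<lambda>t. indicator {x<..y} t *\<^sub>R k t)" "integrable lebesgue (\<lambda>t. indicator {x<..y} t *\<^sub>R D)"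
        using set_integrable_bounded_interval[of k D x y] set_integrable_bounded_interval[of "\<lambda>_. D" D x y] kD
        by (auto simp: set_integrable_def D_def)
    qed (use kD in \<open>auto simp: indicator_def\<close>)
    also have "\<dots> = D * (y - x)"
      using that by (simp add: set_lebesgue_integral_def)
    finally show ?thesis .
  qed
  have lip: "D-lipschitz_on UNIV H"
  proof (rule lipschitz_onI)
    show "dist (H x) (H y) \<le> D * dist x y" for x y
      using int[of x y] int[of y x] Hk[of x y] Hk[of y x] by (cases "x \<le> y") (auto simp: dist_real_def)
  qed (simp add: D_def)
  note cont = lipschitz_on_continuous_on[OF lip]
  have "AE x in lebesgue. \<forall>\<eta>>0. \<exists>d>0. \<forall>a b. a < x \<longrightarrow> x < b \<longrightarrow> b - a < d \<longrightarrow> H b - H a \<le> (k x + \<eta>) * (b - a)"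
    using kD Hk by (intro lebesgue_upper_slope) auto
  moreover have "AE x in lebesgue. \<forall>\<eta>>0. \<exists>d>0. \<forall>a b. a < x \<longrightarrow> x < b \<longrightarrow> b - a < d \<longrightarrow> (- H b) - (- H a) \<le> (- k x + \<eta>) * (b - a)"
  proof (intro lebesgue_upper_slope)
    show "- H y - - H x = (LINT t:{x<..y}|lebesgue. - k t)" if "x \<le> y" for x y
      using Hk[OF that] by (simp add: set_lebesgue_integral_def)
  qed (use kD in auto)
  ultimately show ?thesis using hk
  proof eventually_elim
    case (elim x)
    have "((\<lambda>y. (H y - H x) / (y - x)) \<longlongrightarrow> h x) (at x)"
    proof (rule LIM_I)
      fix r :: real assume "0 < r"
      then have r: "0 < r / 2" by simp
      obtain d1 where d1: "d1 > 0" "\<And>a b. a < x \<Longrightarrow> x < b \<Longrightarrow> b - a < d1 \<Longrightarrow> H b - H a \<le> (k x + r/2) * (b - a)"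
        using elim(1) r by blast
      obtain d2 where d2: "d2 > 0" "\<And>a b. a < x \<Longrightarrow> x < b \<Longrightarrow> b - a < d2 \<Longrightarrow> - H b - - H a \<le> (- k x + r/2) * (b - a)"
        using elim(2) r by blast
      have "norm ((H y - H x) / (y - x) - h x) < r" if "y \<noteq> x" "norm (y - x) < min d1 d2" for y
      proof -
        have "(H y - H x) / (y - x) \<le> k x + r/2"
          using that by (intro slope_bound_endpoints[OF cont d1(2)]) auto
        moreover have "(- H y - - H x) / (y - x) \<le> - k x + r/2"
          using that by (intro slope_bound_endpoints[OF continuous_on_minus[OF cont] d2(2)]) auto
        then have "- ((H y - H x) / (y - x)) \<le> - k x + r/2"
          by (simp add: minus_divide_left)
        ultimately show ?thesis using elim(3) \<open>0 < r\<close> by (simp add: abs_if)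
      qed
      then show "\<exists>s>0. \<forall>y. y \<noteq> x \<and> norm (y - x) < s \<longrightarrow> norm ((H y - H x) / (y - x) - h x) < r"
        using d1(1) d2(1) by (intro exI[of _ "min d1 d2"]) auto
    qed
    then show ?case by (simp add: has_field_derivative_iff)
  qed
qed

section \<open>Lipschitz functions as indefinite integrals\<close>

text \<open>
  Two increasing functions with sum \<open>x\<close> have Stieltjes measures that add up to Lebesgue measure. In
  particular both measures are dominated by Lebesgue measure, which is how they get bounded
  densities below.
\<close>

lemma interval_measures_sum_lborel:
  fixes G1 G2 :: "real \<Rightarrow> real"
  assumes mono: "mono G1" "mono G2" and cont: "continuous_on UNIV G1" "continuous_on UNIV G2"
    and sum: "\<And>x. G1 x + G2 x = x" and X: "X \<in> sets borel"
  shows "emeasure (interval_measure G1) X + emeasure (interval_measure G2) X = emeasure lborel X"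
proof -
  define S where "S = measure_of UNIV (sets borel)
    (\<lambda>X. emeasure (interval_measure G1) X + emeasure (interval_measure G2) X)"
  have sets_S: "sets S = sets borel"
    unfolding S_def using sets.sigma_sets_eq[of "borel :: real measure"] by (simp add: sets_measure_of)
  have S: "emeasure S X = emeasure (interval_measure G1) X + emeasure (interval_measure G2) X"
    if "X \<in> sets borel" for X
  proof (rule emeasure_measure_of[OF S_def])
    show "countably_additive (sets S) (\<lambda>X. emeasure (interval_measure G1) X + emeasure (interval_measure G2) X)"
      by (auto simp: countably_additive_def sets_S suminf_add[symmetric] suminf_emeasure)
  qed (use that in \<open>auto simp: positive_def sets_S\<close>)
  have "lborel = S"
  proof (rule lborel_eqI)
    fix l u :: real assume lu: "\<And>b. b \<in> Basis \<Longrightarrow> l \<bullet> b \<le> u \<bullet> b"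
    then have "l \<le> u" by simp
    have single: "emeasure (interval_measure G) {u} = 0" if "mono G" "continuous_on UNIV G" for G
      using emeasure_interval_measure_Icc[of u u G] that by (simp add: monoD)
    have Ioc: "emeasure S {l<..u} = ennreal (u - l)"
    proof -
      have "emeasure S {l<..u} = ennreal (G1 u - G1 l) + ennreal (G2 u - G2 l)"
        using mono cont \<open>l \<le> u\<close>
        by (subst S) (auto simp: emeasure_interval_measure_Ioc monoD continuous_on_eq_continuous_at
            continuous_at_imp_continuous_within)
      also have "\<dots> = ennreal ((G1 u - G1 l) + (G2 u - G2 l))"
        using mono[THEN monoD, OF \<open>l \<le> u\<close>] by (simp add: ennreal_plus)
      also have "(G1 u - G1 l) + (G2 u - G2 l) = u - l"
        using sum[of u] sum[of l] by linarith
      finally show ?thesis .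
    qed
    have "emeasure S {u} = 0" using S[of "{u}"] single mono cont by simp
    then have "emeasure S ({l<..<u} \<union> {u}) = emeasure S {l<..<u}"
      by (intro emeasure_Un_null_set) (auto simp: sets_S null_sets_def)
    moreover have "emeasure S {l<..<u} = emeasure S {l<..u}"
    proof (cases "l < u")
      case True
      then have "{l<..<u} \<union> {u} = {l<..u}" by auto
      with calculation show ?thesis by simp
    qed (use \<open>l \<le> u\<close> in auto)
    ultimately show "emeasure S (box l u) = (\<Prod>b\<in>Basis. (u - l) \<bullet> b)"
      using Ioc by (simp add: box_real)
  qed (simp add: sets_S)
  with S[OF X] show ?thesis by simp
qed

text \<open>
  Scaled to Lipschitz constant below \<open>1\<close>, the function \<open>H\<close> becomes the difference of the two
  increasing functions \<open>(x \<plusminus> H x / c) / 2\<close>, whose sum is \<open>x\<close>. The Stieltjes measure of the first has a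
  Radon--Nikodym density \<open>g\<close>, and \<open>0 \<le> g \<le> 1\<close> since the other density is \<open>1 - g\<close>. Hence \<open>H\<close> is
  the integral of \<open>c (2 g - 1)\<close>.
\<close>

theorem lipschitz_indefinite_integral:
  fixes H :: "real \<Rightarrow> real"
  assumes lip: "L-lipschitz_on UNIV H"
  obtains h where "h \<in> borel_measurable borel" "\<And>x. \<bar>h x\<bar> \<le> L + 1"
    "\<And>x y. x \<le> y \<Longrightarrow> H y - H x = (LINT t:{x<..y}|lebesgue. h t)"
proof -
  \<comment> \<open>\<open>L\<close> may be \<open>0\<close>, and the scaling factor has to be positive\<close>
  define c where "c = L + 1"
  have "0 \<le> L" using lip by (rule lipschitz_on_nonneg)
  then have "0 < c" by (simp add: c_def)
  have Hc: "\<bar>H y - H x\<bar> \<le> c * (y - x)" if "x \<le> y" for x y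
    using lipschitz_onD[OF lip, of y x] that mult_right_mono[of L c "y - x"] by (simp add: dist_real_def c_def)
  have contH: "continuous_on UNIV H" using lip by (rule lipschitz_on_continuous_on)
  define G1 where "G1 = (\<lambda>x. (x + H x / c) / 2)"
  define G2 where "G2 = (\<lambda>x. (x - H x / c) / 2)"
  have mono: "mono G1" "mono G2"
  proof -
    have "G1 x \<le> G1 y \<and> G2 x \<le> G2 y" if "x \<le> y" for x y
    proof -
      have "\<bar>(H y - H x) / c\<bar> \<le> y - x"
        using Hc[OF that] \<open>0 < c\<close> by (simp add: field_simps)
      then have "H y / c - H x / c \<le> y - x" "H x / c - H y / c \<le> y - x"
        by (simp_all add: diff_divide_distrib abs_le_iff)
      then show ?thesis unfolding G1_def G2_def by (intro conjI divide_right_mono) auto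
    qed
    then show "mono G1" "mono G2" by (auto simp: mono_def)
  qed
  have cont: "continuous_on UNIV G1" "continuous_on UNIV G2"
    unfolding G1_def G2_def using contH \<open>0 < c\<close> by (auto intro!: continuous_intros)
  have sum: "G1 x + G2 x = x" for x by (simp add: G1_def G2_def field_simps)
  note total = interval_measures_sum_lborel[OF mono cont sum]
  have "absolutely_continuous lborel (interval_measure G1)" "absolutely_continuous lborel (interval_measure G2)"
    unfolding absolutely_continuous_def null_sets_def using total by (auto simp: set_eq_iff) (metis add_eq_0_iff_both_eq_0)+
  then obtain f1 f2 where f [measurable]: "f1 \<in> borel_measurable lborel" "f2 \<in> borel_measurable lborel"
    and dens: "density lborel f1 = interval_measure G1" "density lborel f2 = interval_measure G2"
    using sigma_finite_measure.Radon_Nikodym[OF sigma_finite_lborel] by (metis sets_interval_measure sets_lborel)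
  have "AE x in lborel. f1 x + f2 x = 1"
  proof (rule sigma_finite_measure.density_unique[OF sigma_finite_lborel])
    show "density lborel (\<lambda>x. f1 x + f2 x) = density lborel (\<lambda>x. 1)"
    proof (rule measure_eqI)
      fix X assume "X \<in> sets (density lborel (\<lambda>x. f1 x + f2 x))"
      then have X [measurable]: "X \<in> sets borel" by simp
      have "emeasure (density lborel (\<lambda>x. f1 x + f2 x)) X = emeasure (density lborel f1) X + emeasure (density lborel f2) X"
        by (simp add: emeasure_density distrib_right nn_integral_add)
      then show "emeasure (density lborel (\<lambda>x. f1 x + f2 x)) X = emeasure (density lborel (\<lambda>x. 1)) X"
        using total[OF X] by (simp add: dens emeasure_density)
    qed simp
  qed auto
  then have le1: "AE x in lborel. f1 x \<le> 1"
    by eventually_elim (metis add_increasing2 order_refl zero_le)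
  define g where "g = (\<lambda>x. min 1 (enn2real (f1 x)))"
  have g [measurable]: "g \<in> borel_measurable borel" by (simp add: g_def)
  have g01: "0 \<le> g x" "g x \<le> 1" for x by (auto simp: g_def)
  have fg: "AE x in lborel. f1 x = ennreal (g x)"
    using le1
  proof eventually_elim
    case (elim x)
    then have "f1 x = ennreal (enn2real (f1 x))"
      by (metis ennreal_enn2real ennreal_one_less_top order_le_less_trans)
    moreover from this elim have "enn2real (f1 x) \<le> 1" by (simp add: enn2real_leI)
    ultimately show ?case by (simp add: g_def min_def)
  qed
  have g_leb [measurable]: "g \<in> borel_measurable lebesgue" using g by (simp add: measurable_completion)
  have int: "(LINT t:{x<..y}|lebesgue. g t) = G1 y - G1 x" if "x \<le> y" for x y
  proof -
    have "ennreal (LINT t:{x<..y}|lebesgue. g t) = emeasure (density lebesgue (\<lambda>x. ennreal (g x))) {x..y}"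
      using g01 by (intro emeasure_density_interval[symmetric]) auto
    also have "\<dots> = (\<integral>\<^sup>+t. ennreal (g t) * indicator {x..y} t \<partial>lebesgue)"
      by (intro emeasure_density) auto
    also have "\<dots> = (\<integral>\<^sup>+t. ennreal (g t) * indicator {x..y} t \<partial>lborel)"
      by (rule nn_integral_completion)
    also have "\<dots> = (\<integral>\<^sup>+t. f1 t * indicator {x..y} t \<partial>lborel)"
      using fg by (intro nn_integral_cong_AE) (auto elim: eventually_mono)
    also have "\<dots> = emeasure (density lborel f1) {x..y}"
      by (intro emeasure_density[symmetric]) auto
    also have "\<dots> = ennreal (G1 y - G1 x)"
      unfolding dens using that mono cont by (intro emeasure_interval_measure_Icc) (auto simp: monoD)
    finally show ?thesis
      using that mono g01 by (subst (asm) ennreal_inj) (auto simp: monoD set_lebesgue_integral_def intro!: integral_nonneg)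
  qed
  show ?thesis
  proof
    show "(\<lambda>x. c * (2 * g x - 1)) \<in> borel_measurable borel" by measurable
    show "\<bar>c * (2 * g x - 1)\<bar> \<le> L + 1" for x
    proof -
      have "\<bar>2 * g x - 1\<bar> \<le> 1" using g01[of x] by (simp add: abs_le_iff)
      then show ?thesis using \<open>0 < c\<close> mult_left_mono[of "\<bar>2 * g x - 1\<bar>" 1 c] by (simp add: abs_mult c_def)
    qed
    show "H y - H x = (LINT t:{x<..y}|lebesgue. c * (2 * g t - 1))" if "x \<le> y" for x y
    proof -
      have "(LINT t:{x<..y}|lebesgue. c * (2 * g t - 1)) = c * (LINT t:{x<..y}|lebesgue. 2 * g t - 1)"
        by simp
      also have "(LINT t:{x<..y}|lebesgue. 2 * g t - 1) = (LINT t:{x<..y}|lebesgue. 2 * g t) - (LINT t:{x<..y}|lebesgue. 1)"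
      proof (rule set_integral_diff)
        show "set_integrable lebesgue {x<..y} (\<lambda>t. 2 * g t)"
          using g01 by (intro set_integrable_bounded_interval[where C=2]) auto
      qed (rule set_integrable_bounded_interval[where C=1]; simp)
      also have "\<dots> = 2 * (G1 y - G1 x) - (y - x)"
        using int[OF that] that by (simp add: set_lebesgue_integral_def)
      also have "c * (2 * (G1 y - G1 x) - (y - x)) = H y - H x"
        using \<open>0 < c\<close> by (simp add: G1_def field_simps)
      finally show ?thesis by simp
    qed
  qed
qed

lemma negligible_of_AE:
  fixes P :: "real \<Rightarrow> bool"
  assumes "AE x in lebesgue. \<not> P x"
  shows "negligible {x. P x}"
proof -
  obtain N where N: "N \<in> null_sets lebesgue" "{x \<in> space lebesgue. \<not> \<not> P x} \<subseteq> N"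
    using assms unfolding eventually_ae_filter by blast
  have "negligible N" using N(1) by (simp add: negligible_iff_null_sets)
  then show ?thesis by (rule negligible_subset) (use N(2) in simp)
qed

text \<open>
  Rademacher's theorem on an interval. Extended constantly beyond the endpoints, \<open>F\<close> is an
  indefinite integral.
\<close>

lemma lipschitz_AE_differentiable:
  fixes F :: "real \<Rightarrow> real"
  assumes F: "L-lipschitz_on {0..a} F" and "0 \<le> a"
  shows "negligible {t. 0 < t \<and> t < a \<and> \<not> (\<exists>d. (F has_real_derivative d) (at t))}"
proof -
  define H where "H = (\<lambda>t. F (max 0 (min a t)))"
  have "\<bar>max 0 (min a s) - max 0 (min a t)\<bar> \<le> \<bar>s - t\<bar>" for s t
    by (simp add: max_def min_def abs_if)
  then have "1-lipschitz_on UNIV (\<lambda>t::real. max 0 (min a t))"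
    by (intro lipschitz_onI) (simp_all add: dist_real_def)
  moreover have "range (\<lambda>t::real. max 0 (min a t)) \<subseteq> {0..a}" using \<open>0 \<le> a\<close> by auto
  ultimately have "(L * 1)-lipschitz_on UNIV H"
    unfolding H_def by (intro lipschitz_on_compose2 lipschitz_on_subset[OF F])
  then obtain h where h: "h \<in> borel_measurable borel" "\<And>x. \<bar>h x\<bar> \<le> L * 1 + 1"
    "\<And>x y. x \<le> y \<Longrightarrow> H y - H x = (LINT t:{x<..y}|lebesgue. h t)"
    by (rule lipschitz_indefinite_integral) blast
  have "h \<in> borel_measurable lebesgue" using h(1) by (simp add: measurable_completion)
  then have "AE t in lebesgue. (H has_real_derivative h t) (at t)"
    using h by (intro lebesgue_differentiation[where C="L * 1 + 1"]) auto
  then have "AE t in lebesgue. \<not> (0 < t \<and> t < a \<and> \<not> (\<exists>d. (F has_real_derivative d) (at t)))"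
  proof eventually_elim
    case (elim t)
    have "(F has_real_derivative h t) (at t)" if "0 < t" "t < a"
    proof (rule has_field_derivative_transform_within_open[OF elim open_greaterThanLessThan])
      show "t \<in> {0<..<a}" using that by simp
      show "H s = F s" if "s \<in> {0<..<a}" for s using that by (simp add: H_def)
    qed
    then show ?case by blast
  qed
  then show ?thesis by (rule negligible_of_AE)
qed

lemma negligible_lipschitz_image:
  fixes f :: "real \<Rightarrow> real"
  assumes "L-lipschitz_on S f" "negligible S"
  shows "negligible (f ` S)"
proof (rule negligible_locally_Lipschitz_image)
  fix x assume "x \<in> S"
  then show "\<exists>T B. open T \<and> x \<in> T \<and> (\<forall>y\<in>S \<inter> T. norm (f y - f x) \<le> B * norm (y - x))"
    using lipschitz_onD[OF assms(1)] by (intro exI[of _ UNIV] exI[of _ L]) (auto simp: dist_norm)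
qed (use assms in auto)


section \<open>Primitives on a compact set of positive measure\<close>

text \<open>
  Values off \<open>[0, a]\<close> are irrelevant, so an element of the space has many representatives here.
\<close>

definition Lip0 :: "real \<Rightarrow> (real \<Rightarrow> real) set" where
  "Lip0 a = {F. (\<exists>L. L-lipschitz_on {0..a} F) \<and> F 0 = 0}"

lemma Lip0_continuous: "F \<in> Lip0 a \<Longrightarrow> continuous_on {0..a} F"
  by (auto simp: Lip0_def intro: lipschitz_on_continuous_on)

lemma ident_Lip0: "(\<lambda>x. x) \<in> Lip0 a"
  by (auto simp: Lip0_def intro!: exI[of _ 1] lipschitz_onI)

lemma Lip0_add: "F \<in> Lip0 c \<Longrightarrow> G \<in> Lip0 c \<Longrightarrow> (\<lambda>x. F x + G x) \<in> Lip0 c"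
  by (auto simp: Lip0_def intro: lipschitz_on_add)

lemma Lip0_scale: "F \<in> Lip0 c \<Longrightarrow> (\<lambda>x. r * F x) \<in> Lip0 c"
  by (auto simp: Lip0_def intro: lipschitz_on_cmult_real)

lemma Lip0_compose:
  assumes F: "F \<in> Lip0 a" and \<psi>: "L-lipschitz_on {0..m} \<psi>" "\<And>t. t \<in> {0..m} \<Longrightarrow> \<psi> t \<in> {0..a}" "\<psi> 0 = 0"
  shows "(\<lambda>t. c * F (\<psi> t)) \<in> Lip0 m"
proof -
  obtain L' where L': "L'-lipschitz_on {0..a} F" and F0: "F 0 = 0" using F by (auto simp: Lip0_def)
  have "\<psi> ` {0..m} \<subseteq> {0..a}" using \<psi>(2) by auto
  then have "(L' * L)-lipschitz_on {0..m} (\<lambda>t. F (\<psi> t))"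
    using lipschitz_on_compose2[OF \<psi>(1) lipschitz_on_subset[OF L']] by blast
  then have "(\<bar>c\<bar> * (L' * L))-lipschitz_on {0..m} (\<lambda>t. c * F (\<psi> t))"
    by (rule lipschitz_on_cmult_real)
  with F0 \<psi>(3) show ?thesis by (auto simp: Lip0_def)
qed

locale positive_compact =
  fixes K :: "real set"
  assumes compact: "compact K" and positive: "0 < measure lebesgue K"
begin

lemma nonempty: "K \<noteq> {}"
  using positive by auto

lemma lmeasurable: "K \<in> lmeasurable"
  using compact by (rule lmeasurable_compact)

lemma sets_lebesgue [measurable, simp]: "K \<in> sets lebesgue"
  using lmeasurable by (rule fmeasurableD)

lemma initial_part_eq: "initial_part K x = {..x} \<inter> K"
proof -
  obtain a where a: "a \<in> K" "\<And>x. x \<in> K \<Longrightarrow> a \<le> x"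
    using compact_attains_inf[OF compact nonempty] by blast
  have "(LEAST a. a \<in> K) = a" using a by (intro Least_equality)
  with a show ?thesis by (auto simp: initial_part_def)
qed

lemma initial_part_lmeasurable [simp]: "{..x} \<inter> K \<in> lmeasurable"
  by (rule fmeasurableI2[OF lmeasurable Int_lower2 sets.Int]) simp_all

text \<open>
  All integrals over parts of \<open>K\<close> are turned into integrals of this extension by zero, which is
  integrable on the whole line.
\<close>

lemma ess_bounded_restrict:
  assumes f: "f \<in> ess_bounded K"
  defines "k \<equiv> \<lambda>t. indicator K t * f t"
  obtains C where "0 \<le> C" "AE t in lebesgue. \<bar>k t\<bar> \<le> C * indicator K t" "k \<in> borel_measurable lebesgue" "integrable lebesgue k"
proof -
  from f obtain C where "AE x in lebesgue_on K. \<bar>f x\<bar> \<le> C" by (auto simp: ess_bounded_def)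
  then have "AE x in lebesgue. x \<in> K \<longrightarrow> \<bar>f x\<bar> \<le> C" by (simp add: AE_restrict_space_iff)
  then have AE: "AE t in lebesgue. \<bar>k t\<bar> \<le> max C 0 * indicator K t"
    by eventually_elim (auto simp: k_def indicator_def)
  have meas: "k \<in> borel_measurable lebesgue"
    unfolding k_def using f by (simp add: ess_bounded_def borel_measurable_restrict_space_iff)
  have "integrable lebesgue k"
  proof (rule integrableI_bounded_set[of K])
    show "emeasure lebesgue K < \<infinity>" using lmeasurable by (simp add: fmeasurable_def)
    show "AE x in lebesgue. x \<in> K \<longrightarrow> norm (k x) \<le> max C 0"
      using AE by eventually_elim (auto simp: indicator_def)
  qed (use meas in \<open>auto simp: k_def\<close>)
  with AE meas show ?thesis by (intro that[of "max C 0"]) auto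
qed

lemma primitive_diff:
  assumes f: "f \<in> ess_bounded K" and "x \<le> y"
  shows "primitive K f y - primitive K f x = (LINT t:{x<..y}|lebesgue. indicator K t * f t)"
proof -
  let ?k = "\<lambda>t. indicator K t * f t"
  obtain C where k: "?k \<in> borel_measurable lebesgue" "integrable lebesgue ?k"
    by (rule ess_bounded_restrict[OF f])
  have eq: "primitive K f x = (LINT t:{..x}|lebesgue. ?k t)" for x
    unfolding primitive_def initial_part_eq set_lebesgue_integral_def
    by (intro Bochner_Integration.integral_cong) (auto simp: indicator_def)
  have "{..y} = {..x} \<union> {x<..y}" using \<open>x \<le> y\<close> by auto
  moreover have "(LINT t:{..x} \<union> {x<..y}|lebesgue. ?k t) = (LINT t:{..x}|lebesgue. ?k t) + (LINT t:{x<..y}|lebesgue. ?k t)"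
    by (rule set_integral_Un) (auto simp: set_integrable_def intro!: integrable_mult_indicator[OF _ k(2), simplified])
  ultimately show ?thesis by (simp add: eq)
qed

lemma one_ess_bounded: "(\<lambda>_. 1) \<in> ess_bounded K"
  by (auto simp: ess_bounded_def)

text \<open>
  Facts on primitives thereby yield facts on the measure projection.
\<close>

lemma measure_proj_eq_primitive: "measure_proj K x = primitive K (\<lambda>_. 1) x"
  unfolding measure_proj_def primitive_def initial_part_eq set_lebesgue_integral_def by simp

lemma primitive_bound:
  assumes f: "f \<in> ess_bounded K"
  obtains C where "0 \<le> C"
    "\<And>x y. \<bar>primitive K f y - primitive K f x\<bar> \<le> C * \<bar>measure_proj K y - measure_proj K x\<bar>"
proof -
  let ?k = "\<lambda>t. indicator K t * f t"
  obtain C where C: "0 \<le> C" "AE t in lebesgue. \<bar>?k t\<bar> \<le> C * indicator K t"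
    and k: "?k \<in> borel_measurable lebesgue" "integrable lebesgue ?k"
    by (rule ess_bounded_restrict[OF f])
  have iK: "integrable lebesgue (\<lambda>t. indicator K t :: real)"
    using lmeasurable by (simp add: fmeasurable_def)
  have le: "\<bar>primitive K f y - primitive K f x\<bar> \<le> C * (measure_proj K y - measure_proj K x)" if "x \<le> y" for x y
  proof -
    have i1: "integrable lebesgue (\<lambda>t. indicator {x<..y} t * ?k t)"
      using integrable_mult_indicator[OF _ k(2), of "{x<..y}"] by simp
    have i2: "integrable lebesgue (\<lambda>t. C * (indicator {x<..y} t * indicator K t) :: real)"
      using integrable_mult_indicator[OF _ iK, of "{x<..y}"] by (intro integrable_mult_right) simp
    have "\<bar>LINT t:{x<..y}|lebesgue. ?k t\<bar> \<le> (LINT t|lebesgue. \<bar>indicator {x<..y} t * ?k t\<bar>)"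
      unfolding set_lebesgue_integral_def real_scaleR_def by (rule integral_abs_bound)
    also have "\<dots> \<le> (LINT t|lebesgue. C * (indicator {x<..y} t * indicator K t))"
      using i1 i2 C(2) by (intro integral_mono_AE) (auto elim!: eventually_mono simp: indicator_def)
    also have "\<dots> = C * (LINT t:{x<..y}|lebesgue. indicator K t * 1)"
      by (simp add: set_lebesgue_integral_def)
    also have "\<dots> = C * (measure_proj K y - measure_proj K x)"
      using primitive_diff[OF one_ess_bounded that] by (simp add: measure_proj_eq_primitive)
    finally show ?thesis using primitive_diff[OF f that] by simp
  qed
  show ?thesis
  proof (rule that[OF C(1)])
    fix x y
    have *: "C * c \<le> C * \<bar>c\<bar>" for c using C(1) by (intro mult_left_mono) auto
    show "\<bar>primitive K f y - primitive K f x\<bar> \<le> C * \<bar>measure_proj K y - measure_proj K x\<bar>"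
    proof (cases "x \<le> y")
      case True with le[of x y] *[of "measure_proj K y - measure_proj K x"] show ?thesis by linarith
    next
      case False
      with le[of y x] *[of "measure_proj K x - measure_proj K y"] show ?thesis
        by (simp add: abs_minus_commute)
    qed
  qed
qed

lemma measure_proj_diff:
  assumes "x \<le> y"
  shows "measure_proj K y - measure_proj K x = (LINT t:{x<..y}|lebesgue. indicator K t)"
  using primitive_diff[OF one_ess_bounded assms] by (simp add: measure_proj_eq_primitive)

lemma measure_proj_mono:
  assumes "x \<le> y"
  shows "measure_proj K x \<le> measure_proj K y"
proof -
  have "{..x} \<inter> K \<subseteq> {..y} \<inter> K" using assms by auto
  then have "measure lebesgue ({..x} \<inter> K) \<le> measure lebesgue ({..y} \<inter> K)"
    by (intro measure_mono_fmeasurable) (simp_all add: fmeasurableD)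
  then show ?thesis by (simp only: measure_proj_def initial_part_eq)
qed

lemma measure_proj_lipschitz: "1-lipschitz_on UNIV (measure_proj K)"
proof (rule lipschitz_onI)
  have le: "measure_proj K y - measure_proj K x \<le> y - x" if "x \<le> y" for x y
  proof -
    have "measure_proj K y - measure_proj K x \<le> (LINT t|lebesgue. indicator {x<..y} t)"
      unfolding measure_proj_diff[OF that] set_lebesgue_integral_def
    proof (rule integral_mono)
      show "integrable lebesgue (\<lambda>t. indicator {x<..y} t *\<^sub>R indicator K t :: real)"
        using set_integrable_bounded_interval[of "indicator K" 1 x y] by (auto simp: set_integrable_def)
      show "integrable lebesgue (\<lambda>t. indicator {x<..y} t :: real)"
        using set_integrable_bounded_interval[of "\<lambda>_. 1" 1 x y] by (auto simp: set_integrable_def)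
    qed (auto simp: indicator_def)
    then show ?thesis using that by simp
  qed
  show "dist (measure_proj K x) (measure_proj K y) \<le> 1 * dist x y" for x y
  proof (cases "x \<le> y")
    case True
    with le[OF True] measure_proj_mono[OF True] show ?thesis by (simp add: dist_real_def)
  next
    case False
    then have "y \<le> x" by simp
    with le[OF this] measure_proj_mono[OF this] show ?thesis by (simp add: dist_real_def)
  qed
qed simp

lemma continuous_measure_proj: "continuous_on A (measure_proj K)"
  using lipschitz_on_continuous_on[OF measure_proj_lipschitz] by (rule continuous_on_subset) simp

lemma measure_proj_range: "measure_proj K x \<in> {0..measure lebesgue K}"
proof -
  have "measure lebesgue ({..x} \<inter> K) \<le> measure lebesgue K"
    by (intro measure_mono_fmeasurable lmeasurable) (simp_all add: fmeasurableD)
  then show ?thesis by (simp add: measure_proj_def initial_part_eq)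
qed

lemma measure_proj_eq_total:
  assumes "\<And>z. z \<in> K \<Longrightarrow> z \<le> x"
  shows "measure_proj K x = measure lebesgue K"
proof -
  have "{..x} \<inter> K = K" using assms by auto
  then show ?thesis by (simp add: measure_proj_def initial_part_eq)
qed

lemma measure_proj_gap:
  assumes "x \<le> y" "{x<..y} \<inter> K = {}"
  shows "measure_proj K y = measure_proj K x"
proof -
  have "z \<le> x" if "z \<in> K" "z \<le> y" for z
  proof (rule ccontr)
    assume "\<not> z \<le> x"
    with that have "z \<in> {x<..y} \<inter> K" by simp
    with assms(2) show False by blast
  qed
  then have "{..y} \<inter> K = {..x} \<inter> K"
    using assms(1) by auto
  then show ?thesis by (simp add: measure_proj_def initial_part_eq)
qed

text \<open>
  The intermediate value theorem gives a point of the line; the last point of \<open>K\<close> before it has the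
  same projection.
\<close>

lemma measure_proj_surj:
  assumes "t \<in> {0..measure lebesgue K}"
  shows "\<exists>x\<in>K. measure_proj K x = t"
proof -
  obtain a where a: "a \<in> K" "\<And>x. x \<in> K \<Longrightarrow> a \<le> x"
    using compact_attains_inf[OF compact nonempty] by blast
  obtain b where b: "b \<in> K" "\<And>x. x \<in> K \<Longrightarrow> x \<le> b"
    using compact_attains_sup[OF compact nonempty] by blast
  have P0: "measure_proj K a = 0"
  proof -
    have "{..a} \<inter> K = {a}" using a by (auto intro: antisym)
    then show ?thesis by (simp add: measure_proj_def initial_part_eq)
  qed
  have "measure_proj K b = measure lebesgue K" using b by (intro measure_proj_eq_total) auto
  with assms P0 a b obtain y where y: "a \<le> y" "y \<le> b" "measure_proj K y = t"
    using IVT'[of "measure_proj K" a t b] continuous_measure_proj by auto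
  obtain x where x: "x \<in> K \<inter> {a..y}" "\<And>z. z \<in> K \<inter> {a..y} \<Longrightarrow> z \<le> x"
  proof -
    have "compact (K \<inter> {a..y})" "K \<inter> {a..y} \<noteq> {}"
      using compact a y by (auto intro: compact_Int)
    from compact_attains_sup[OF this] that show ?thesis by blast
  qed
  have "{x<..y} \<inter> K = {}"
  proof (rule equals0I)
    fix z assume "z \<in> {x<..y} \<inter> K"
    with x(2)[of z] a(2)[of z] show False by auto
  qed
  with x have "measure_proj K y = measure_proj K x" by (intro measure_proj_gap) auto
  with x y show ?thesis by auto
qed

lemma left_selector:
  assumes "t \<in> {0..measure lebesgue K}"
  shows left_selector_in: "left_selector K t \<in> K" and measure_proj_left_selector: "measure_proj K (left_selector K t) = t"
proof -
  let ?S = "{x\<in>K. measure_proj K x = t}"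
  have "?S = K \<inter> (measure_proj K -` {t} \<inter> UNIV)" by auto
  moreover have "closed (measure_proj K -` {t})"
    using continuous_measure_proj[of UNIV]
    by (intro continuous_closed_vimage) (simp_all add: continuous_on_eq_continuous_at)
  ultimately have "compact ?S" using compact by (simp add: compact_Int_closed)
  have "?S \<noteq> {}" using measure_proj_surj[OF assms] by auto
  then obtain x where x: "x \<in> ?S" "\<And>y. y \<in> ?S \<Longrightarrow> x \<le> y"
    using compact_attains_inf[OF \<open>compact ?S\<close>] by blast
  then have "left_selector K t = x"
    unfolding left_selector_def by (intro Least_equality) auto
  with x show "left_selector K t \<in> K" "measure_proj K (left_selector K t) = t" by auto
qed

lemma measure_proj_image: "measure_proj K ` K = {0..measure lebesgue K}"
proof
  show "measure_proj K ` K \<subseteq> {0..measure lebesgue K}"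
    by (rule image_subsetI) (rule measure_proj_range)
  show "{0..measure lebesgue K} \<subseteq> measure_proj K ` K"
  proof
    fix t assume "t \<in> {0..measure lebesgue K}"
    from measure_proj_surj[OF this] show "t \<in> measure_proj K ` K" by auto
  qed
qed

lemma exists_below:
  obtains z where "z \<le> x" "{..z} \<inter> K = {}"
proof -
  obtain a where a: "a \<in> K" "\<And>x. x \<in> K \<Longrightarrow> a \<le> x"
    using compact_attains_inf[OF compact nonempty] by blast
  have "{..min x (a - 1)} \<inter> K = {}"
  proof (rule equals0I)
    fix z assume "z \<in> {..min x (a - 1)} \<inter> K"
    with a(2)[of z] show False by auto
  qed
  then show ?thesis by (intro that[of "min x (a - 1)"]) auto
qed

text \<open>
  The primitive moves at most \<open>C\<close> times as much as the measure projection, so it is constant where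
  the projection is constant, and the factor is Lipschitz. The left-endpoint selector picks one
  point from each level set of the projection.
\<close>

lemma primitive_factors:
  assumes f: "f \<in> ess_bounded K"
  obtains F where "F \<in> Lip0 (measure lebesgue K)" "\<And>x. primitive K f x = F (measure_proj K x)"
proof -
  obtain C where C: "0 \<le> C"
    "\<And>x y. \<bar>primitive K f y - primitive K f x\<bar> \<le> C * \<bar>measure_proj K y - measure_proj K x\<bar>"
    by (rule primitive_bound[OF f]) blast
  define F where "F = (\<lambda>t. primitive K f (left_selector K t))"
  have fact: "primitive K f x = F (measure_proj K x)" for x
    using C(2)[of x "left_selector K (measure_proj K x)"] measure_proj_left_selector[OF measure_proj_range]
    by (simp add: F_def)
  have "C-lipschitz_on {0..measure lebesgue K} F"
  proof (rule lipschitz_onI)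
    fix s t assume "s \<in> {0..measure lebesgue K}" "t \<in> {0..measure lebesgue K}"
    then show "dist (F s) (F t) \<le> C * dist s t"
      using C(2)[of "left_selector K s" "left_selector K t"]
      by (simp add: F_def dist_real_def measure_proj_left_selector)
  qed (rule C(1))
  moreover have "F 0 = 0"
  proof -
    obtain z where "{..z} \<inter> K = {}" using exists_below[of 0] by blast
    then have "measure_proj K z = 0" "primitive K f z = 0"
      by (simp_all add: measure_proj_def primitive_def initial_part_eq set_lebesgue_integral_def)
    with fact[of z] show ?thesis by simp
  qed
  ultimately show ?thesis using fact by (intro that) (auto simp: Lip0_def)
qed

lemma primitive_has_derivative:
  assumes f: "f \<in> ess_bounded K"
  shows "AE x in lebesgue. (primitive K f has_real_derivative indicator K x * f x) (at x)"
proof -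
  obtain C where C: "0 \<le> C" "AE t in lebesgue. \<bar>indicator K t * f t\<bar> \<le> C * indicator K t"
    and k: "(\<lambda>t. indicator K t * f t) \<in> borel_measurable lebesgue"
    by (rule ess_bounded_restrict[OF f])
  show ?thesis
  proof (rule lebesgue_differentiation[OF k])
    show "AE t in lebesgue. \<bar>indicator K t * f t\<bar> \<le> C"
      using C(2) by eventually_elim (use C(1) in \<open>auto simp: indicator_def split: if_splits\<close>)
  qed (rule primitive_diff[OF f])
qed

lemma measure_proj_has_derivative:
  "AE x in lebesgue. (measure_proj K has_real_derivative indicator K x) (at x)"
proof -
  have "measure_proj K = primitive K (\<lambda>_. 1)" by (rule ext) (rule measure_proj_eq_primitive)
  with primitive_has_derivative[OF one_ess_bounded] show ?thesis by simp
qed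

text \<open>
  A function is almost everywhere the derivative of its primitive. Equality of the primitives on
  \<open>K\<close> extends to the whole line because both depend on the measure projection only.
\<close>

lemma primitive_inject:
  assumes f: "f \<in> ess_bounded K" and g: "g \<in> ess_bounded K"
    and eq: "\<And>x. x \<in> K \<Longrightarrow> primitive K f x = primitive K g x"
  shows "(f, g) \<in> ae_eq K"
proof -
  have "primitive K f x = primitive K g x" for x
  proof -
    obtain F where F: "\<And>x. primitive K f x = F (measure_proj K x)"
      by (rule primitive_factors[OF f]) blast
    obtain G where G: "\<And>x. primitive K g x = G (measure_proj K x)"
      by (rule primitive_factors[OF g]) blast
    obtain x' where "x' \<in> K" "measure_proj K x' = measure_proj K x"
      using measure_proj_surj[OF measure_proj_range] by blast
    with F[of x] F[of x'] G[of x] G[of x'] eq[of x'] show ?thesis by simp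
  qed
  then have *: "primitive K f = primitive K g" by auto
  have "AE x in lebesgue. x \<in> K \<longrightarrow> f x = g x"
    using primitive_has_derivative[OF f] primitive_has_derivative[OF g]
    by eventually_elim (auto simp: * dest: DERIV_unique)
  with f g show ?thesis by (simp add: ae_eq_def AE_restrict_space_iff)
qed

text \<open>
  The function \<open>F \<circ> measure_proj K\<close> is Lipschitz on the line, hence the integral of a bounded
  function. As it is locally constant off \<open>K\<close>, that function vanishes almost everywhere off \<open>K\<close>.
\<close>

lemma primitive_surj:
  assumes F: "F \<in> Lip0 (measure lebesgue K)"
  obtains f where "f \<in> ess_bounded K" "\<And>x. primitive K f x = F (measure_proj K x)"
proof -
  obtain L where L: "L-lipschitz_on {0..measure lebesgue K} F" and F0: "F 0 = 0"
    using F by (auto simp: Lip0_def)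
  define H where "H = (\<lambda>x. F (measure_proj K x))"
  have lipH: "L-lipschitz_on UNIV H"
    unfolding H_def
    using lipschitz_on_compose[OF measure_proj_lipschitz, of L F] lipschitz_on_subset[OF L] measure_proj_range
    by (auto simp: o_def image_subset_iff)
  obtain h where h: "h \<in> borel_measurable borel" "\<And>x. \<bar>h x\<bar> \<le> L + 1"
    "\<And>x y. x \<le> y \<Longrightarrow> H y - H x = (LINT t:{x<..y}|lebesgue. h t)"
    by (rule lipschitz_indefinite_integral[OF lipH]) blast
  have [measurable]: "h \<in> borel_measurable lebesgue" using h(1) by (simp add: measurable_completion)
  have hess: "h \<in> ess_bounded K"
    using h(2) by (auto simp: ess_bounded_def intro!: measurable_restrict_space1)
  have off: "AE x in lebesgue. h x = indicator K x * h x"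
  proof -
    have "AE x in lebesgue. (H has_real_derivative h x) (at x)"
      using h by (intro lebesgue_differentiation[where C="L+1"]) auto
    then show ?thesis
    proof eventually_elim
      case (elim x)
      show ?case
      proof (cases "x \<in> K")
        case False
        then obtain e where e: "e > 0" "ball x e \<subseteq> - K"
          using open_contains_ball[of "- K"] compact_imp_closed[OF compact] by (auto simp: open_Compl)
        have Heq: "H y = H x" if "y \<in> ball x e" for y
        proof (cases "x \<le> y")
          case True
          have "{x<..y} \<subseteq> ball x e" using that by (auto simp: dist_real_def)
          with e(2) have "{x<..y} \<inter> K = {}" by blast
          with True show ?thesis unfolding H_def by (simp add: measure_proj_gap)
        next
          case False
          have "{y<..x} \<subseteq> ball x e" using that by (auto simp: dist_real_def)
          with e(2) have "{y<..x} \<inter> K = {}" by blast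
          with False show ?thesis unfolding H_def using measure_proj_gap[of y x] by simp
        qed
        have "(H has_real_derivative 0) (at x)"
        proof (rule has_field_derivative_transform_within_open[OF DERIV_const open_ball])
          show "x \<in> ball x e" using e(1) by simp
          show "H x = H y" if "y \<in> ball x e" for y using Heq[OF that] by (rule sym)
        qed
        with elim False show ?thesis by (auto dest: DERIV_unique)
      qed simp
    qed
  qed
  have "primitive K h x = H x" for x
  proof -
    obtain z where "z \<le> x" and e: "{..z} \<inter> K = {}" using exists_below[of x] .
    then have 0: "H z = 0" "primitive K h z = 0"
      by (simp_all add: H_def F0 measure_proj_def primitive_def initial_part_eq set_lebesgue_integral_def)
    have "H x - H z = (LINT t:{z<..x}|lebesgue. indicator K t * h t)"
      unfolding h(3)[OF \<open>z \<le> x\<close>] set_lebesgue_integral_def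
      using off by (intro integral_cong_AE borel_measurable_scaleR borel_measurable_indicator borel_measurable_times)
        (auto elim: eventually_mono)
    with primitive_diff[OF hess \<open>z \<le> x\<close>] 0 show ?thesis by simp
  qed
  with hess show ?thesis by (intro that) (auto simp: H_def)
qed

text \<open>
  The measure projection maps Lebesgue measure on \<open>K\<close> to Lebesgue measure on \<open>[0, |K|]\<close>: the
  points of \<open>K\<close> with projection above \<open>t\<close> are those beyond a point with projection \<open>t\<close>, so
  their measure is \<open>|K| - t\<close>.
\<close>

lemma negligible_measure_proj_vimage:
  assumes "negligible S"
  shows "negligible {x\<in>K. measure_proj K x \<in> S}"
proof -
  let ?a = "measure lebesgue K" and ?P = "measure_proj K"
  have P [measurable]: "?P \<in> borel_measurable borel"
    by (intro borel_measurable_continuous_onI continuous_measure_proj)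
  have Kb [measurable]: "K \<in> sets borel" using compact by (rule borel_compact)
  define D where "D = distr (density lborel (indicator K)) borel ?P"
  have D: "emeasure D X = emeasure lborel (K \<inter> ?P -` X)" if "X \<in> sets borel" for X
  proof -
    have [measurable]: "?P -` X \<in> sets borel" using P that by (metis measurable_sets_borel)
    have "emeasure D X = emeasure (density lborel (indicator K)) (?P -` X)"
      unfolding D_def using that by (subst emeasure_distr) auto
    also have "\<dots> = (\<integral>\<^sup>+x. indicator (K \<inter> ?P -` X) x \<partial>lborel)"
      by (subst emeasure_density) (auto intro!: nn_integral_cong split: split_indicator simp del: nn_integral_indicator)
    also have "\<dots> = emeasure lborel (K \<inter> ?P -` X)"
      by (rule nn_integral_indicator) auto
    finally show ?thesis .
  qed
  have "D = density lborel (indicator {0..?a})"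
  proof (rule measure_eqI_lessThan)
    fix t
    have R: "emeasure (density lborel (indicator {0..?a})) {t<..} = emeasure lborel ({0..?a} \<inter> {t<..})"
    proof -
      have "emeasure (density lborel (indicator {0..?a})) {t<..} = (\<integral>\<^sup>+x. indicator ({0..?a} \<inter> {t<..}) x \<partial>lborel)"
        by (subst emeasure_density) (auto intro!: nn_integral_cong split: split_indicator simp del: nn_integral_indicator)
      then show ?thesis by (simp add: nn_integral_indicator)
    qed
    have L: "emeasure D {t<..} = emeasure lborel {x\<in>K. t < ?P x}"
      by (subst D) (auto intro!: arg_cong[where f="emeasure lborel"])
    have "emeasure lborel {x\<in>K. t < ?P x} = emeasure lborel ({0..?a} \<inter> {t<..})"
    proof -
      consider "t < 0" | "t \<in> {0..?a}" | "?a < t" by fastforce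
      then show ?thesis
      proof cases
        case 1
        have "0 \<le> ?P x" for x using measure_proj_range[of x] by simp
        then have "{x\<in>K. t < ?P x} = K" "{0..?a} \<inter> {t<..} = {0..?a}"
          using 1 by (auto intro: less_le_trans)
        then show ?thesis using emeasure_eq_measure2[OF lmeasurable] by simp
      next
        case 3
        have "?P x \<le> ?a" for x using measure_proj_range[of x] by simp
        then have "\<not> t < ?P x" for x using 3 by (meson le_less_trans less_asym)
        then have "{x\<in>K. t < ?P x} = {}" "{0..?a} \<inter> {t<..} = {}"
          using 3 by auto
        then show ?thesis by (simp only: emeasure_empty)
      next
        case 2
        define S where "S = {x\<in>K. ?P x \<le> t}"
        have "S = K \<inter> ?P -` {..t}" by (auto simp: S_def)
        moreover have "closed (?P -` {..t})"
          using continuous_measure_proj[of UNIV]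
    by (intro continuous_closed_vimage) (simp_all add: continuous_on_eq_continuous_at)
        ultimately have "compact S" using compact by (simp add: compact_Int_closed)
        have "S \<noteq> {}" using measure_proj_surj[OF 2] by (auto simp: S_def)
        then obtain x where x: "x \<in> S" "\<And>y. y \<in> S \<Longrightarrow> y \<le> x"
          using compact_attains_sup[OF \<open>compact S\<close>] by blast
        obtain x' where x': "x' \<in> K" "?P x' = t" using measure_proj_surj[OF 2] by blast
        have Px: "?P x = t"
          using x(1) x(2)[of x'] x' measure_proj_mono[of x' x] by (auto simp: S_def)
        have "t < ?P z \<longleftrightarrow> \<not> z \<le> x" if "z \<in> K" for z
          using x(2)[of z] measure_proj_mono[of z x] Px that by (auto simp: S_def not_le[symmetric])
        then have "{x\<in>K. t < ?P x} = K - ({..x} \<inter> K)" by auto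
        moreover have "measure lebesgue (K - ({..x} \<inter> K)) = ?a - t"
          using lmeasurable Px
          by (subst measurable_measure_Diff) (auto simp: measure_proj_def initial_part_eq intro: fmeasurableI2)
        moreover have "{0..?a} \<inter> {t<..} = {t<..?a}" using 2 by auto
        moreover have "emeasure lborel (K - ({..x} \<inter> K)) = ennreal (measure lebesgue (K - ({..x} \<inter> K)))"
        proof -
          have "K - ({..x} \<inter> K) \<in> lmeasurable"
            using lmeasurable by (rule fmeasurableI2) auto
          then have "emeasure lebesgue (K - ({..x} \<inter> K)) = ennreal (measure lebesgue (K - ({..x} \<inter> K)))"
            by (rule emeasure_eq_measure2)
          then show ?thesis by simp
        qed
        moreover have "emeasure lborel {t<..?a} = ennreal (?a - t)"
          using 2 by (intro emeasure_lborel_Ioc) simp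
        ultimately show ?thesis by (simp only:)
      qed
    qed
    with R L show eq: "emeasure D {t<..} = emeasure (density lborel (indicator {0..?a})) {t<..}" by simp
    have "emeasure lborel ({0..?a} \<inter> {t<..}) \<le> emeasure lborel {0..?a}"
      by (intro emeasure_mono) auto
    with R eq show "emeasure D {t<..} < \<infinity>" by (simp add: top.not_eq_extremum le_less_trans)
  qed (auto simp: D_def)
  then have Db: "emeasure lborel (K \<inter> ?P -` X) = emeasure (density lborel (indicator {0..?a})) X" if "X \<in> sets borel" for X
    using D[OF that] by simp
  obtain N where N: "N \<in> null_sets lborel" "S \<subseteq> N"
    using assms by (metis negligible_iff_null_sets null_sets_completion_iff2)
  then have [measurable]: "N \<in> sets borel" by auto
  have "emeasure lborel (K \<inter> ?P -` N) = (\<integral>\<^sup>+x. indicator {0..?a} x * indicator N x \<partial>lborel)"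
    by (simp add: Db emeasure_density)
  also have "\<dots> = 0"
    using AE_not_in[OF N(1)] by (subst nn_integral_0_iff_AE) (auto elim: eventually_mono)
  finally have "K \<inter> ?P -` N \<in> null_sets lborel"
    using measurable_sets_borel[OF P, of N] by auto
  then have "negligible (K \<inter> ?P -` N)" by (simp add: negligible_iff_null_sets null_sets_completionI)
  then show ?thesis by (rule negligible_subset) (use N in auto)
qed

end

section \<open>Surjective sup-norm isometries of Lipschitz functions\<close>

definition tent :: "real \<Rightarrow> real \<Rightarrow> real" where
  "tent t x = max 0 (1 - \<bar>x - t\<bar> / t)"

lemma tent_Lip0:
  assumes "0 < t"
  shows "tent t \<in> Lip0 a"
proof -
  have "(1 / t)-lipschitz_on {0..a} (tent t)"
  proof (rule lipschitz_onI)
    fix x y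
    have "\<bar>max 0 (1 - p) - max 0 (1 - q)\<bar> \<le> \<bar>p - q\<bar>" for p q :: real
      by (auto simp: max_def abs_if)
    then have "\<bar>tent t x - tent t y\<bar> \<le> \<bar>\<bar>x - t\<bar> / t - \<bar>y - t\<bar> / t\<bar>"
      unfolding tent_def .
    also have "\<dots> = \<bar>\<bar>x - t\<bar> - \<bar>y - t\<bar>\<bar> / t"
      using assms by (simp add: diff_divide_distrib[symmetric])
    also have "\<dots> \<le> \<bar>x - y\<bar> / t"
      using assms by (intro divide_right_mono) auto
    finally show "dist (tent t x) (tent t y) \<le> 1 / t * dist x y"
      by (simp add: dist_real_def)
  qed (use assms in simp)
  moreover have "tent t 0 = 0" using assms by (simp add: tent_def)
  ultimately show ?thesis by (auto simp: Lip0_def)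
qed

lemma tent_peak: "tent t t = 1"
  by (simp add: tent_def)

lemma tent_range: "0 < t \<Longrightarrow> 0 \<le> tent t x \<and> tent t x \<le> 1"
  by (simp add: tent_def)

lemma tent_eq_1D: "0 < t \<Longrightarrow> \<bar>tent t x\<bar> = 1 \<Longrightarrow> x = t"
  by (auto simp: tent_def max_def split: if_splits)

text \<open>
  A surjective linear isometry is described as a relation rather than as a map. This makes the
  situation symmetric, so that every lemma also holds for the inverse, and it copes with functions
  that have several representatives. The norm is compared through its bounds.
\<close>

locale sup_isometry =
  fixes a m :: real and R :: "(real \<Rightarrow> real) \<Rightarrow> (real \<Rightarrow> real) \<Rightarrow> bool"
  assumes a_pos: "0 < a" and m_pos: "0 < m"
    and left: "R F G \<Longrightarrow> F \<in> Lip0 a" and right: "R F G \<Longrightarrow> G \<in> Lip0 m"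
    and add: "R F G \<Longrightarrow> R F' G' \<Longrightarrow> R (\<lambda>x. F x + F' x) (\<lambda>x. G x + G' x)"
    and scale: "R F G \<Longrightarrow> R (\<lambda>x. c * F x) (\<lambda>x. c * G x)"
    and left_total: "F \<in> Lip0 a \<Longrightarrow> \<exists>G. R F G" and right_total: "G \<in> Lip0 m \<Longrightarrow> \<exists>F. R F G"
    and norm: "R F G \<Longrightarrow> (\<forall>t\<in>{0..a}. \<bar>F t\<bar> \<le> C) \<longleftrightarrow> (\<forall>t\<in>{0..m}. \<bar>G t\<bar> \<le> C)"
begin

lemma converse: "sup_isometry m a (\<lambda>G F. R F G)"
proof
  show "(\<forall>t\<in>{0..m}. \<bar>G t\<bar> \<le> C) \<longleftrightarrow> (\<forall>t\<in>{0..a}. \<bar>F t\<bar> \<le> C)" if "R F G" for F G C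
    using norm[OF that, of C] by (rule sym)
qed (fact m_pos a_pos | erule (1) add | erule left right scale left_total right_total)+

text \<open>
  Convexity of the set of functions whose images take the value \<open>1\<close> at \<open>t\<close>, in the form needed for
  finite intersections, with sums in place of means.
\<close>

lemma sum_related:
  assumes "finite I" "\<And>F. F \<in> I \<Longrightarrow> \<exists>G. R F G \<and> G t = 1"
  shows "\<exists>G. R (\<lambda>x. \<Sum>F\<in>I. F x) G \<and> G t = real (card I)"
  using assms
proof (induction I rule: finite_induct)
  case empty
  obtain G where "R (tent 1) G" using left_total[OF tent_Lip0[of 1]] by auto
  from scale[OF this, of 0] show ?case by auto
next
  case (insert F I)
  then obtain G where "R (\<lambda>x. \<Sum>F\<in>I. F x) G" "G t = real (card I)" by auto
  moreover obtain G' where "R F G'" "G' t = 1" using insert by auto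
  ultimately have "R (\<lambda>x. F x + (\<Sum>F\<in>I. F x)) (\<lambda>x. G' x + G x)" "G' t + G t = real (card (insert F I))"
    using insert add by auto
  with insert show ?case by auto
qed

text \<open>
  Take finitely many functions of norm at most \<open>1\<close> whose images take the value \<open>1\<close> at \<open>t\<close>. Their sum
  has norm at least their number, because its image has. At a point \<open>u\<close> where the absolute value of
  the sum is maximal, all summands therefore have the same value \<open>1\<close> or \<open>-1\<close>. The finite
  intersection property, for pairs of a point and a sign, extends this to all such functions at once.
\<close>

lemma common_peak:
  assumes t: "t \<in> {0..m}"
  obtains u \<sigma> where "u \<in> {0..a}" "\<sigma> \<in> {1, -1}"
    "\<And>F G. R F G \<Longrightarrow> (\<And>x. x \<in> {0..a} \<Longrightarrow> \<bar>F x\<bar> \<le> 1) \<Longrightarrow> G t = 1 \<Longrightarrow> F u = \<sigma>"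
proof -
  define S where "S = {0..a} \<times> {1, -1 :: real}"
  define \<F> where "\<F> = {F. (\<forall>x\<in>{0..a}. \<bar>F x\<bar> \<le> 1) \<and> (\<exists>G. R F G \<and> G t = 1)}"
  define Z where "Z = (\<lambda>F. {z \<in> S. F (fst z) - snd z = 0})"
  have "compact S" 
    unfolding S_def by (intro compact_Times compact_Icc finite_imp_compact) auto
  have "S \<inter> \<Inter>(Z ` \<F>) \<noteq> {}"
  proof (rule compact_imp_fip_image[OF \<open>compact S\<close>])
    fix F assume "F \<in> \<F>"
    then have "continuous_on {0..a} F" using left Lip0_continuous by (auto simp: \<F>_def)
    then have "continuous_on S (\<lambda>z. F (fst z))"
      by (rule continuous_on_compose2[OF _ continuous_on_fst[OF continuous_on_id]]) (auto simp: S_def)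
    then have "continuous_on S (\<lambda>z. F (fst z) - snd z)"
      by (rule continuous_on_diff[OF _ continuous_on_snd[OF continuous_on_id]])
    then show "closed (Z F)"
      unfolding Z_def using compact_imp_closed[OF \<open>compact S\<close>] by (rule continuous_closed_preimage_constant)
  next
    fix I assume I: "finite I" "I \<subseteq> \<F>"
    define s where "s = (\<lambda>x. \<Sum>F\<in>I. F x)"
    obtain G where G: "R s G" "G t = real (card I)"
      using sum_related[OF I(1), of t] I(2) by (auto simp: s_def \<F>_def)
    have "continuous_on {0..a} (\<lambda>x. \<bar>s x\<bar>)"
      using Lip0_continuous[OF left[OF G(1)]] by (intro continuous_intros)
    then obtain u where u: "u \<in> {0..a}" "\<And>x. x \<in> {0..a} \<Longrightarrow> \<bar>s x\<bar> \<le> \<bar>s u\<bar>"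
      using continuous_attains_sup[of "{0..a}" "\<lambda>x. \<bar>s x\<bar>"] a_pos by auto
    define \<sigma> :: real where "\<sigma> = (if 0 \<le> s u then 1 else -1)"
    have "\<bar>G t\<bar> \<le> \<bar>s u\<bar>" using norm[OF G(1), of "\<bar>s u\<bar>"] u(2) t by blast
    then have "real (card I) \<le> \<sigma> * s u" using G(2) by (auto simp: \<sigma>_def)
    then have "(\<Sum>F\<in>I. 1 - \<sigma> * F u) \<le> 0"
      by (simp add: sum_subtractf sum_distrib_left s_def)
    moreover have nonneg: "0 \<le> 1 - \<sigma> * F u" if "F \<in> I" for F
    proof -
      have "\<bar>F u\<bar> \<le> 1" using that I(2) u(1) by (auto simp: \<F>_def)
      then show ?thesis by (auto simp: \<sigma>_def)
    qed
    ultimately have "(\<Sum>F\<in>I. 1 - \<sigma> * F u) = 0"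
      using sum_nonneg[of I "\<lambda>F. 1 - \<sigma> * F u"] by fastforce
    then have "1 - \<sigma> * F u = 0" if "F \<in> I" for F
      using sum_nonneg_eq_0_iff[OF I(1), of "\<lambda>F. 1 - \<sigma> * F u"] nonneg that by simp
    then have "\<sigma> * F u = 1" if "F \<in> I" for F
      using that by fastforce
    then have "F u - \<sigma> = 0" if "F \<in> I" for F
      using that by (cases "0 \<le> s u") (force simp: \<sigma>_def)+
    moreover have "(u, \<sigma>) \<in> S" using u(1) by (auto simp: S_def \<sigma>_def)
    ultimately have "(u, \<sigma>) \<in> S \<inter> \<Inter>(Z ` I)" by (auto simp: Z_def)
    then show "S \<inter> \<Inter>(Z ` I) \<noteq> {}" by blast
  qed
  then obtain z where z: "z \<in> S" "\<And>F. F \<in> \<F> \<Longrightarrow> z \<in> Z F" by blast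
  show ?thesis
  proof (rule that)
    show "fst z \<in> {0..a}" "snd z \<in> {1, -1}" using z(1) by (auto simp: S_def)
    fix F G assume "R F G" "\<And>x. x \<in> {0..a} \<Longrightarrow> \<bar>F x\<bar> \<le> 1" "G t = 1"
    then have "F \<in> \<F>" by (auto simp: \<F>_def)
    from z(2)[OF this] show "F (fst z) = snd z" by (simp add: Z_def)
  qed
qed

lemma unit_related:
  assumes "R F G"
  shows "(\<forall>x\<in>{0..a}. \<bar>F x\<bar> \<le> 1) \<longleftrightarrow> (\<forall>x\<in>{0..m}. \<bar>G x\<bar> \<le> 1)"
  by (rule norm[OF assms])

text \<open>
  Apply the common peak lemma to \<open>t\<close> to get \<open>u\<close>, and to \<open>u\<close> in the inverse direction to get \<open>t'\<close>.
  The tent with tip at \<open>t\<close> takes absolute value \<open>1\<close> only there, which forces \<open>t' = t\<close>.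
\<close>

lemma peak_correspondence:
  assumes t: "t \<in> {0<..m}"
  obtains u \<sigma> where "u \<in> {0<..a}" "\<sigma> \<in> {1, -1}"
    "\<And>F G. R F G \<Longrightarrow> (\<And>x. x \<in> {0..a} \<Longrightarrow> \<bar>F x\<bar> \<le> 1) \<Longrightarrow> F u = 1 \<Longrightarrow> G t = \<sigma>"
proof -
  interpret C: sup_isometry m a "\<lambda>G F. R F G" by (rule converse)
  obtain u \<sigma> where u: "u \<in> {0..a}" "\<sigma> \<in> {1, -1}" and
    u1: "\<And>F G. R F G \<Longrightarrow> (\<And>x. x \<in> {0..a} \<Longrightarrow> \<bar>F x\<bar> \<le> 1) \<Longrightarrow> G t = 1 \<Longrightarrow> F u = \<sigma>"
    by (rule common_peak[of t]) (use t in auto)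
  obtain t' \<sigma>' where t': "t' \<in> {0..m}" "\<sigma>' \<in> {1, -1}" and
    t'1: "\<And>F G. R F G \<Longrightarrow> (\<And>x. x \<in> {0..m} \<Longrightarrow> \<bar>G x\<bar> \<le> 1) \<Longrightarrow> F u = 1 \<Longrightarrow> G t' = \<sigma>'"
    by (rule C.common_peak[OF u(1)]) blast
  obtain F0 where F0: "R F0 (tent t)"
    using right_total[OF tent_Lip0[of t]] t by auto
  have tent1: "\<bar>tent t x\<bar> \<le> 1" for x using tent_range[of t x] t by auto
  then have F01: "\<bar>F0 x\<bar> \<le> 1" if "x \<in> {0..a}" for x using unit_related[OF F0] that by blast
  have F0u: "F0 u = \<sigma>" using u1[OF F0 F01 tent_peak] .
  have "R (\<lambda>x. \<sigma> * F0 x) (\<lambda>x. \<sigma> * tent t x)" by (rule scale[OF F0])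
  moreover have "\<bar>\<sigma> * tent t x\<bar> \<le> 1" for x using u(2) tent1[of x] by auto
  moreover have "\<sigma> * F0 u = 1" using u(2) F0u by auto
  ultimately have eq: "\<sigma> * tent t t' = \<sigma>'" by (rule t'1)
  then have "\<bar>tent t t'\<bar> = 1" using u(2) t'(2) by auto
  from tent_eq_1D[OF _ this] have "t' = t" using t by simp
  with eq have "\<sigma>' = \<sigma>" by (simp add: tent_peak)
  have "F0 0 = 0" using left[OF F0] by (simp add: Lip0_def)
  with F0u u have "u \<in> {0<..a}" by (cases "u = 0") auto
  then show ?thesis
  proof (rule that[OF _ u(2)])
    fix F G assume FG: "R F G" "\<And>x. x \<in> {0..a} \<Longrightarrow> \<bar>F x\<bar> \<le> 1" "F u = 1"
    then have "\<bar>G x\<bar> \<le> 1" if "x \<in> {0..m}" for x using unit_related[OF FG(1)] that by blast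
    from t'1[OF FG(1) this FG(3)] show "G t = \<sigma>" using \<open>t' = t\<close> \<open>\<sigma>' = \<sigma>\<close> by simp
  qed
qed

text \<open>
  A sufficiently tall tent with tip at \<open>u\<close> turns an arbitrary \<open>F\<close> into a function that peaks at \<open>u\<close>.
  The peak correspondence determines the images of the tent and of the sum at \<open>t\<close>, hence by
  linearity that of \<open>F\<close>.
\<close>

lemma point_evaluation:
  assumes t: "t \<in> {0<..m}"
  obtains u \<sigma> where "u \<in> {0<..a}" "\<sigma> \<in> {1, -1}" "\<And>F G. R F G \<Longrightarrow> G t = \<sigma> * F u"
proof -
  obtain u \<sigma> where u: "u \<in> {0<..a}" "\<sigma> \<in> {1, -1}" and
    peak: "\<And>F G. R F G \<Longrightarrow> (\<And>x. x \<in> {0..a} \<Longrightarrow> \<bar>F x\<bar> \<le> 1) \<Longrightarrow> F u = 1 \<Longrightarrow> G t = \<sigma>"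
    by (rule peak_correspondence[OF t]) blast
  have "u > 0" using u by simp
  obtain Q where Q: "R (tent u) Q"
    using left_total[OF tent_Lip0[OF \<open>u > 0\<close>]] by auto
  have Qt: "Q t = \<sigma>" using peak[OF Q _ tent_peak] tent_range[OF \<open>u > 0\<close>] by simp
  have "G t = \<sigma> * F u" if FG: "R F G" for F G
  proof -
    obtain L where L: "L-lipschitz_on {0..a} F" using left[OF FG] by (auto simp: Lip0_def)
    have "0 \<le> L" using L by (rule lipschitz_on_nonneg)
    have F0: "F 0 = 0" using left[OF FG] by (simp add: Lip0_def)
    have Lb: "\<bar>F x - F y\<bar> \<le> L * \<bar>x - y\<bar>" if "x \<in> {0..a}" "y \<in> {0..a}" for x y
      using lipschitz_onD[OF L that] by (simp add: dist_real_def)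
    have B: "\<bar>F x\<bar> \<le> L * a" if "x \<in> {0..a}" for x
      using Lb[OF that, of 0] F0 that mult_left_mono[of "\<bar>x\<bar>" a L] \<open>0 \<le> L\<close> by auto
    \<comment> \<open>the slope \<open>N / u\<close> of the tent beats the Lipschitz constant of \<open>F\<close> on the support of the tent, and off the support the height beats \<open>\<bar>F\<bar> \<le> L * a\<close>\<close>
    define N where "N = L * u + 2 * (L * a) + 1"
    define c where "c = F u + N"
    have ua: "u \<in> {0..a}" using u by auto
    have La: "0 \<le> L * a" "0 \<le> L * u" using \<open>0 \<le> L\<close> a_pos \<open>u > 0\<close> by auto
    have c: "0 < c" using B[OF ua] La by (auto simp: c_def N_def)
    have bound: "\<bar>F x + N * tent u x\<bar> \<le> c" if x: "x \<in> {0..a}" for x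
    proof -
      have "0 \<le> N * tent u x" using La tent_range[OF \<open>u > 0\<close>, of x] by (auto simp: N_def)
      then have "- c \<le> F x + N * tent u x" using B[OF x] B[OF ua] La by (auto simp: c_def N_def)
      moreover have "F x + N * tent u x \<le> c"
      proof (cases "\<bar>x - u\<bar> \<le> u")
        case True
        then have "tent u x = 1 - \<bar>x - u\<bar> / u" using \<open>u > 0\<close> by (simp add: tent_def max_def field_simps)
        moreover have "L * \<bar>x - u\<bar> \<le> N * (\<bar>x - u\<bar> / u)"
        proof -
          have "L * \<bar>x - u\<bar> = (L * u) * (\<bar>x - u\<bar> / u)" using \<open>u > 0\<close> by simp
          also have "\<dots> \<le> N * (\<bar>x - u\<bar> / u)"
            using La \<open>u > 0\<close> by (intro mult_right_mono) (auto simp: N_def)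
          finally show ?thesis .
        qed
        moreover have "F x \<le> F u + L * \<bar>x - u\<bar>" using Lb[OF x ua] by auto
        ultimately show ?thesis by (simp add: c_def right_diff_distrib)
      next
        case False
        then have "1 - \<bar>x - u\<bar> / u \<le> 0" using \<open>u > 0\<close> by (simp add: field_simps)
        then have "tent u x = 0" by (simp add: tent_def)
        with B[OF x] B[OF ua] La show ?thesis by (auto simp: c_def N_def)
      qed
      ultimately show ?thesis by (simp add: abs_le_iff)
    qed
    have "R (\<lambda>x. inverse c * (F x + N * tent u x)) (\<lambda>x. inverse c * (G x + N * Q x))"
      by (intro scale add FG Q)
    then have "inverse c * (G t + N * Q t) = \<sigma>"
    proof (rule peak)
      show "\<bar>inverse c * (F x + N * tent u x)\<bar> \<le> 1" if "x \<in> {0..a}" for x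
        using bound[OF that] c by (simp add: abs_mult field_simps)
      show "inverse c * (F u + N * tent u u) = 1"
        using c by (simp add: tent_peak c_def)
    qed
    then have "G t + N * \<sigma> = \<sigma> * c" using c Qt by (simp add: field_simps)
    then show ?thesis by (simp add: c_def algebra_simps)
  qed
  with u show ?thesis by (intro that) auto
qed

text \<open>
  Evaluating the image \<open>J\<close> of the identity, \<open>u\<close> is the absolute value and \<open>\<sigma>\<close> the sign of \<open>J t\<close>. Since
  \<open>J\<close> is continuous and has no zero in \<open>(0, m]\<close>, the sign is constant.
\<close>

lemma weighted_composition:
  obtains \<epsilon> \<psi> L where "\<epsilon> \<in> {1, -1}" "L-lipschitz_on {0..m} \<psi>" "\<psi> 0 = 0"
    "\<And>t. t \<in> {0..m} \<Longrightarrow> \<psi> t \<in> {0..a}"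
    "\<And>F G t. R F G \<Longrightarrow> t \<in> {0..m} \<Longrightarrow> G t = \<epsilon> * F (\<psi> t)"
proof -
  obtain J where J: "R (\<lambda>x. x) J" using left_total[OF ident_Lip0] by auto
  obtain L where L: "L-lipschitz_on {0..m} J" and J0: "J 0 = 0"
    using right[OF J] by (auto simp: Lip0_def)
  have eval: "\<exists>u\<in>{0<..a}. \<exists>\<sigma>\<in>{1, -1}. J t = \<sigma> * u \<and> (\<forall>F G. R F G \<longrightarrow> G t = \<sigma> * F u)" if "t \<in> {0<..m}" for t
    by (rule point_evaluation[OF that]) (use J in blast)
  define \<epsilon> where "\<epsilon> = sgn (J m)"
  have \<epsilon>: "\<epsilon> \<in> {1, -1}"
    using eval[of m] m_pos by (auto simp: \<epsilon>_def)
  have contJ: "continuous_on {0..m} J" using L by (rule lipschitz_on_continuous_on)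
  have sgnJ: "sgn (J t) = \<epsilon>" if t: "t \<in> {0<..m}" for t
  proof (rule ccontr)
    assume neq: "sgn (J t) \<noteq> \<epsilon>"
    have nz: "J s \<noteq> 0" if "s \<in> {0<..m}" for s
      using eval[OF that] by auto
    have cont: "continuous_on {t..m} J" using contJ t by (auto intro: continuous_on_subset)
    have "J t \<noteq> 0" "J m \<noteq> 0" using nz t m_pos by auto
    with neq have "J t < 0 \<and> 0 < J m \<or> J m < 0 \<and> 0 < J t"
      by (auto simp: \<epsilon>_def sgn_if split: if_splits)
    then obtain s where "t \<le> s" "s \<le> m" "J s = 0"
      using IVT'[of J t 0 m] IVT2'[of J m 0 t] cont t by force
    with nz[of s] t show False by auto
  qed
  have rep: "\<exists>u\<in>{0<..a}. u = \<epsilon> * J t \<and> (\<forall>F G. R F G \<longrightarrow> G t = \<epsilon> * F u)" if t: "t \<in> {0<..m}" for t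
  proof -
    obtain u \<sigma> where u: "u \<in> {0<..a}" "\<sigma> \<in> {1, -1}" "J t = \<sigma> * u" "\<forall>F G. R F G \<longrightarrow> G t = \<sigma> * F u"
      using eval[OF t] by blast
    then have "\<sigma> = \<epsilon>" using sgnJ[OF t] by auto
    with u show ?thesis by auto
  qed
  show ?thesis
  proof (rule that[OF \<epsilon>])
    show "L-lipschitz_on {0..m} (\<lambda>t. \<epsilon> * J t)"
      using L \<epsilon> by (auto simp: lipschitz_on_def dist_real_def abs_minus_commute)
    show "\<epsilon> * J 0 = 0" by (simp add: J0)
    show "\<epsilon> * J t \<in> {0..a}" if "t \<in> {0..m}" for t
      using rep[of t] that a_pos J0 by (cases "t = 0") auto
    show "G t = \<epsilon> * F (\<epsilon> * J t)" if "R F G" "t \<in> {0..m}" for F G t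
    proof (cases "t = 0")
      case True
      then show ?thesis using left[OF that(1)] right[OF that(1)] J0 by (simp add: Lip0_def)
    next
      case False
      with that rep[of t] show ?thesis by auto
    qed
  qed
qed

text \<open>
  Both directions have the form of a weighted composition; composing them on the identity shows that
  the two signs agree and that \<open>\<psi>\<close> and \<open>\<theta>\<close> are inverse to each other.
\<close>

theorem banach_stone:
  obtains \<epsilon> \<psi> where "\<epsilon> \<in> {1, -1}" "increasing_lipeomorphism {0..m} {0..a} \<psi>"
    "\<And>F G t. R F G \<Longrightarrow> t \<in> {0..m} \<Longrightarrow> G t = \<epsilon> * F (\<psi> t)"
proof -
  interpret C: sup_isometry m a "\<lambda>G F. R F G" by (rule converse)
  obtain \<epsilon> \<psi> L where \<epsilon>: "\<epsilon> \<in> {1, -1}" and \<psi>: "L-lipschitz_on {0..m} \<psi>" "\<psi> 0 = 0"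
    "\<And>t. t \<in> {0..m} \<Longrightarrow> \<psi> t \<in> {0..a}"
    and rep: "\<And>F G t. R F G \<Longrightarrow> t \<in> {0..m} \<Longrightarrow> G t = \<epsilon> * F (\<psi> t)"
    by (rule weighted_composition) blast
  obtain \<delta> \<theta> L' where \<delta>: "\<delta> \<in> {1, -1}" and \<theta>: "L'-lipschitz_on {0..a} \<theta>" "\<theta> 0 = 0"
    "\<And>t. t \<in> {0..a} \<Longrightarrow> \<theta> t \<in> {0..m}"
    and rep': "\<And>F G t. R F G \<Longrightarrow> t \<in> {0..a} \<Longrightarrow> F t = \<delta> * G (\<theta> t)"
    by (rule C.weighted_composition) blast
  obtain J where J: "R (\<lambda>x. x) J" using left_total[OF ident_Lip0] by auto
  obtain I where I: "R I (\<lambda>x. x)" using right_total[OF ident_Lip0] by auto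
  have *: "u = \<delta> * \<epsilon> * \<psi> (\<theta> u)" if "u \<in> {0..a}" for u
    using rep'[OF J that] rep[OF J \<theta>(3)[OF that]] by simp
  have "\<delta> * \<epsilon> = 1"
  proof -
    have "\<delta> * \<epsilon> = 1 \<or> \<delta> * \<epsilon> = -1" using \<epsilon> \<delta> by auto
    moreover have "0 \<le> \<psi> (\<theta> a)" using \<psi>(3)[OF \<theta>(3)[of a]] a_pos by simp
    ultimately show ?thesis using *[of a] a_pos by auto
  qed
  with * have \<psi>\<theta>: "\<psi> (\<theta> u) = u" if "u \<in> {0..a}" for u using that by (metis mult_1)
  have \<theta>\<psi>: "\<theta> (\<psi> t) = t" if "t \<in> {0..m}" for t
    using rep[OF I that] rep'[OF I \<psi>(3)[OF that]] \<open>\<delta> * \<epsilon> = 1\<close>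
    by (metis mult.assoc mult.commute mult_1)
  have cont: "continuous_on {0..m} \<psi>" "continuous_on {0..a} \<theta>"
    using \<psi>(1) \<theta>(1) by (auto intro: lipschitz_on_continuous_on)
  have homeo: "homeomorphism {0..m} {0..a} \<psi> \<theta>"
    using \<psi>(3) \<theta>(3) \<psi>\<theta> \<theta>\<psi> cont by (intro homeomorphismI) (auto simp: image_subset_iff)
  have inj: "inj_on \<psi> {0..m}" using \<theta>\<psi> by (rule inj_on_inverseI)
  have mono: "strict_mono_on {0..m} \<psi>"
  proof (rule strict_mono_onI)
    fix s t assume st: "s \<in> {0..m}" "t \<in> {0..m}" "s < t"
    show "\<psi> s < \<psi> t"
    proof (rule ccontr)
      assume "\<not> \<psi> s < \<psi> t"
      then have "\<psi> t \<le> \<psi> s" by simp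
      moreover have "0 \<le> \<psi> t" using \<psi>(3) st by auto
      moreover have "continuous_on {0..s} \<psi>" using cont(1) st by (auto intro: continuous_on_subset)
      ultimately obtain r where r: "0 \<le> r" "r \<le> s" "\<psi> r = \<psi> t"
        using IVT'[of \<psi> 0 "\<psi> t" s] \<psi>(2) st by auto
      have "r = t" using inj_onD[OF inj r(3)] r st by simp
      with r st show False by simp
    qed
  qed
  show ?thesis
  proof (rule that[OF \<epsilon>, of \<psi>])
    show "increasing_lipeomorphism {0..m} {0..a} \<psi>"
      unfolding increasing_lipeomorphism_def lipeomorphism_def using homeo mono \<psi>(1) \<theta>(1) by blast
  qed (rule rep)
qed

end

section \<open>Classes of essentially bounded functions and their norm\<close>

context positive_compact
begin

lemma set_integrable_initial_part:
  assumes "f \<in> ess_bounded K"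
  shows "set_integrable lebesgue (initial_part K x) f"
proof -
  have "integrable lebesgue (\<lambda>t. indicator K t * f t)"
    by (rule ess_bounded_restrict[OF assms])
  from integrable_mult_indicator[OF _ this, of "{..x}"]
  have "integrable lebesgue (\<lambda>t. indicator {..x} t *\<^sub>R (indicator K t * f t))" by simp
  moreover have "(\<lambda>t. indicator {..x} t *\<^sub>R (indicator K t * f t)) = (\<lambda>t. indicator (initial_part K x) t *\<^sub>R f t)"
    by (auto simp: initial_part_eq indicator_def)
  ultimately show ?thesis by (simp only: set_integrable_def)
qed

lemma Linf_representative:
  assumes "\<Phi> \<in> Linf K"
  obtains f where "f \<in> ess_bounded K" "f \<in> \<Phi>" "\<Phi> = ae_eq K `` {f}"
proof -
  from assms obtain f where "f \<in> ess_bounded K" "\<Phi> = ae_eq K `` {f}"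
    unfolding Linf_def by (rule quotientE)
  then show ?thesis using class_self that by blast
qed

lemma Linf_memberD:
  assumes "\<Phi> \<in> Linf K" "f \<in> \<Phi>"
  shows "f \<in> ess_bounded K" "\<Phi> = ae_eq K `` {f}"
proof -
  obtain g where g: "g \<in> ess_bounded K" "\<Phi> = ae_eq K `` {g}"
    using Linf_representative[OF assms(1)] by blast
  with assms(2) have gf: "(g, f) \<in> ae_eq K" by simp
  then show "f \<in> ess_bounded K" by (simp add: ae_eq_def)
  show "\<Phi> = ae_eq K `` {f}" using g(2) class_eqI[OF gf] by simp
qed

lemma Linf_primitive_member:
  assumes "\<Phi> \<in> Linf K" "f \<in> \<Phi>"
  shows "Linf_primitive K \<Phi> x = primitive K f x"
  using Linf_memberD[OF assms] Linf_primitive_class[OF compact] by simp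

lemma Linf_factors:
  assumes "\<Phi> \<in> Linf K"
  obtains F where "F \<in> Lip0 (measure lebesgue K)" "\<And>x. Linf_primitive K \<Phi> x = F (measure_proj K x)"
proof -
  obtain f where f: "f \<in> ess_bounded K" "f \<in> \<Phi>"
    using Linf_representative[OF assms] by blast
  obtain F where "F \<in> Lip0 (measure lebesgue K)" "\<And>x. primitive K f x = F (measure_proj K x)"
    by (rule primitive_factors[OF f(1)]) blast
  with Linf_primitive_member[OF assms f(2)] show ?thesis by (intro that) auto
qed

lemma Linf_surj:
  assumes "F \<in> Lip0 (measure lebesgue K)"
  obtains \<Phi> where "\<Phi> \<in> Linf K" "\<And>x. Linf_primitive K \<Phi> x = F (measure_proj K x)"
proof -
  obtain f where f: "f \<in> ess_bounded K" "\<And>x. primitive K f x = F (measure_proj K x)"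
    by (rule primitive_surj[OF assms]) blast
  show ?thesis
  proof (rule that)
    show "ae_eq K `` {f} \<in> Linf K" using f(1) by (rule Linf_class)
    show "Linf_primitive K (ae_eq K `` {f}) x = F (measure_proj K x)" for x
      using f Linf_primitive_class[OF compact f(1)] by simp
  qed
qed

lemma Linf_inject:
  assumes "\<Phi> \<in> Linf K" "\<Psi> \<in> Linf K" "\<And>x. x \<in> K \<Longrightarrow> Linf_primitive K \<Phi> x = Linf_primitive K \<Psi> x"
  shows "\<Phi> = \<Psi>"
proof -
  obtain f where f: "f \<in> ess_bounded K" "f \<in> \<Phi>" "\<Phi> = ae_eq K `` {f}"
    using Linf_representative[OF assms(1)] .
  obtain g where g: "g \<in> ess_bounded K" "g \<in> \<Psi>" "\<Psi> = ae_eq K `` {g}"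
    using Linf_representative[OF assms(2)] .
  have "(f, g) \<in> ae_eq K"
  proof (rule primitive_inject[OF f(1) g(1)])
    fix x assume "x \<in> K"
    from assms(3)[OF this] show "primitive K f x = primitive K g x"
      by (simp only: Linf_primitive_member[OF assms(1) f(2)] Linf_primitive_member[OF assms(2) g(2)])
  qed
  with f(3) g(3) show ?thesis by (simp add: class_eqI)
qed

lemma Linf_add_primitive:
  assumes "\<Phi> \<in> Linf K" "\<Psi> \<in> Linf K"
  shows "Linf_add K \<Phi> \<Psi> \<in> Linf K"
    and "Linf_primitive K (Linf_add K \<Phi> \<Psi>) x = Linf_primitive K \<Phi> x + Linf_primitive K \<Psi> x"
proof -
  obtain f where f: "f \<in> ess_bounded K" "f \<in> \<Phi>" "\<Phi> = ae_eq K `` {f}"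
    using Linf_representative[OF assms(1)] .
  obtain g where g: "g \<in> ess_bounded K" "g \<in> \<Psi>" "\<Psi> = ae_eq K `` {g}"
    using Linf_representative[OF assms(2)] .
  have eq: "Linf_add K \<Phi> \<Psi> = ae_eq K `` {\<lambda>x. f x + g x}"
    unfolding f(3) g(3) by (rule Linf_add_class[OF f(1) g(1)])
  note fg = ess_bounded_add[OF f(1) g(1)]
  show "Linf_add K \<Phi> \<Psi> \<in> Linf K" unfolding eq by (rule Linf_class[OF fg])
  have "primitive K (\<lambda>x. f x + g x) x = primitive K f x + primitive K g x"
    unfolding primitive_def using set_integrable_initial_part f(1) g(1) by (intro set_integral_add) auto
  then show "Linf_primitive K (Linf_add K \<Phi> \<Psi>) x = Linf_primitive K \<Phi> x + Linf_primitive K \<Psi> x"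
    unfolding eq Linf_primitive_class[OF compact fg]
    by (simp only: Linf_primitive_member[OF assms(1) f(2)] Linf_primitive_member[OF assms(2) g(2)])
qed

lemma Linf_scale_primitive:
  assumes "\<Phi> \<in> Linf K"
  shows "Linf_scale K c \<Phi> \<in> Linf K"
    and "Linf_primitive K (Linf_scale K c \<Phi>) x = c * Linf_primitive K \<Phi> x"
proof -
  obtain f where f: "f \<in> ess_bounded K" "f \<in> \<Phi>" "\<Phi> = ae_eq K `` {f}"
    using Linf_representative[OF assms(1)] .
  have eq: "Linf_scale K c \<Phi> = ae_eq K `` {\<lambda>x. c * f x}"
    unfolding f(3) by (rule Linf_scale_class[OF f(1)])
  note cf = ess_bounded_scale[OF f(1)]
  show "Linf_scale K c \<Phi> \<in> Linf K" unfolding eq by (rule Linf_class[OF cf])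
  have "primitive K (\<lambda>x. c * f x) x = c * primitive K f x"
    unfolding primitive_def by simp
  then show "Linf_primitive K (Linf_scale K c \<Phi>) x = c * Linf_primitive K \<Phi> x"
    unfolding eq Linf_primitive_class[OF compact cf]
    by (simp only: Linf_primitive_member[OF assms f(2)])
qed

lemma alexiewicz_norm_eq:
  assumes "\<And>x. x \<in> K \<Longrightarrow> Linf_primitive K \<Phi> x = F (measure_proj K x)"
  shows "alexiewicz_norm K \<Phi> = (SUP t\<in>{0..measure lebesgue K}. \<bar>F t\<bar>)"
proof -
  have "(\<lambda>x. \<bar>Linf_primitive K \<Phi> x\<bar>) ` K = (\<lambda>x. \<bar>F (measure_proj K x)\<bar>) ` K"
    using assms by (intro image_cong) auto
  also have "\<dots> = (\<lambda>t. \<bar>F t\<bar>) ` (measure_proj K ` K)" by (simp add: image_image)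
  finally show ?thesis by (simp add: alexiewicz_norm_def measure_proj_image)
qed

lemma alexiewicz_norm_le_iff:
  assumes "\<And>x. x \<in> K \<Longrightarrow> Linf_primitive K \<Phi> x = F (measure_proj K x)" "F \<in> Lip0 (measure lebesgue K)"
  shows "alexiewicz_norm K \<Phi> \<le> C \<longleftrightarrow> (\<forall>t\<in>{0..measure lebesgue K}. \<bar>F t\<bar> \<le> C)"
proof -
  have eq: "alexiewicz_norm K \<Phi> = (SUP t\<in>{0..measure lebesgue K}. \<bar>F t\<bar>)"
    using assms(1) by (rule alexiewicz_norm_eq)
  have "compact ((\<lambda>t. \<bar>F t\<bar>) ` {0..measure lebesgue K})"
    using Lip0_continuous[OF assms(2)] by (intro compact_continuous_image continuous_intros) auto
  then have bdd: "bdd_above ((\<lambda>t. \<bar>F t\<bar>) ` {0..measure lebesgue K})"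
    by (intro bounded_imp_bdd_above compact_imp_bounded)
  show ?thesis unfolding eq by (rule cSUP_le_iff[OF _ bdd]) (use positive in auto)
qed

end

lemma increasing_lipeomorphismE:
  assumes "increasing_lipeomorphism {0..m} {0..a} \<psi>" "0 \<le> m" "0 \<le> a"
  obtains \<theta> L L' where "L-lipschitz_on {0..m} \<psi>" "L'-lipschitz_on {0..a} \<theta>"
    "\<And>t. t \<in> {0..m} \<Longrightarrow> \<psi> t \<in> {0..a}" "\<And>u. u \<in> {0..a} \<Longrightarrow> \<theta> u \<in> {0..m}"
    "\<And>t. t \<in> {0..m} \<Longrightarrow> \<theta> (\<psi> t) = t" "\<And>u. u \<in> {0..a} \<Longrightarrow> \<psi> (\<theta> u) = u"
    "\<psi> 0 = 0" "\<theta> 0 = 0"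
proof -
  from assms(1) obtain \<theta> L L' where h: "homeomorphism {0..m} {0..a} \<psi> \<theta>"
    and L: "L-lipschitz_on {0..m} \<psi>" "L'-lipschitz_on {0..a} \<theta>" and mono: "strict_mono_on {0..m} \<psi>"
    by (auto simp: increasing_lipeomorphism_def lipeomorphism_def)
  have m: "\<psi> t \<in> {0..a}" "\<theta> (\<psi> t) = t" if "t \<in> {0..m}" for t
    using h that by (auto simp: homeomorphism_def)
  have a: "\<theta> u \<in> {0..m}" "\<psi> (\<theta> u) = u" if "u \<in> {0..a}" for u
    using h that by (auto simp: homeomorphism_def)
  have z: "\<theta> 0 \<in> {0..m}" "\<psi> (\<theta> 0) = 0" "\<psi> 0 \<in> {0..a}" using a[of 0] m[of 0] assms(2,3) by auto
  have "\<theta> 0 = 0"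
  proof (rule ccontr)
    assume "\<theta> 0 \<noteq> 0"
    with z assms(2) have "\<psi> 0 < \<psi> (\<theta> 0)" by (intro strict_mono_onD[OF mono]) auto
    with z show False by auto
  qed
  with z show ?thesis using m a L by (intro that[of L L' \<theta>]) auto
qed

section \<open>The pointwise formula\<close>

locale positive_compact_pair = K: positive_compact K + M: positive_compact M for K M
begin

abbreviation "a \<equiv> measure lebesgue K"
abbreviation "m \<equiv> measure lebesgue M"

lemma a_nonneg: "0 \<le> a" and m_nonneg: "0 \<le> m"
  by simp_all

lemma measure_proj_transfer_map:
  assumes "increasing_lipeomorphism {0..m} {0..a} \<psi>"
  shows "measure_proj K (transfer_map M K \<psi> y) = \<psi> (measure_proj M y)"
    and "transfer_map M K \<psi> y \<in> K"
proof -
  have "\<psi> (measure_proj M y) \<in> {0..a}"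
    by (rule increasing_lipeomorphismE[OF assms m_nonneg a_nonneg]) (use M.measure_proj_range in blast)
  then show "measure_proj K (transfer_map M K \<psi> y) = \<psi> (measure_proj M y)" "transfer_map M K \<psi> y \<in> K"
    by (simp_all add: transfer_map_def K.measure_proj_left_selector K.left_selector_in)
qed

text \<open>
  At almost every \<open>y\<close> in \<open>M\<close> the chain rule applies to \<open>\<epsilon> * F (\<psi> (measure_proj M y))\<close>, which equals the
  primitive of \<open>g\<close> on the whole line. The derivative of \<open>F\<close> at \<open>u = measure_proj K x\<close> is \<open>f x\<close>, again
  by the chain rule, at \<open>x\<close>. Null sets are avoided at three places: null sets of \<open>K\<close> are mapped to
  null sets by the measure projection, null sets of \<open>[0, a]\<close> by the Lipschitz inverse of \<open>\<psi>\<close>, and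
  null sets of \<open>[0, m]\<close> are pulled back to null sets of \<open>M\<close>.
\<close>

lemma pointwise_of_primitive:
  assumes \<psi>: "increasing_lipeomorphism {0..m} {0..a} \<psi>"
    and f: "f \<in> ess_bounded K" and g: "g \<in> ess_bounded M"
    and eq: "\<And>y. y \<in> M \<Longrightarrow> primitive M g y = \<epsilon> * primitive K f (transfer_map M K \<psi> y)"
  shows "AE y in lebesgue_on M. g y = \<epsilon> * f (transfer_map M K \<psi> y) * deriv \<psi> (measure_proj M y)"
proof -
  obtain \<theta> L L' where L: "L-lipschitz_on {0..m} \<psi>" "L'-lipschitz_on {0..a} \<theta>"
    and range: "\<And>t. t \<in> {0..m} \<Longrightarrow> \<psi> t \<in> {0..a}" "\<And>u. u \<in> {0..a} \<Longrightarrow> \<theta> u \<in> {0..m}"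
    and inv: "\<And>t. t \<in> {0..m} \<Longrightarrow> \<theta> (\<psi> t) = t"
    by (rule increasing_lipeomorphismE[OF \<psi> m_nonneg a_nonneg]) blast
  obtain F where F: "F \<in> Lip0 a" "\<And>x. primitive K f x = F (measure_proj K x)"
    by (rule K.primitive_factors[OF f]) blast
  obtain G where G: "\<And>y. primitive M g y = G (measure_proj M y)"
    by (rule M.primitive_factors[OF g]) blast
  have prim: "primitive M g y = \<epsilon> * F (\<psi> (measure_proj M y))" for y
  proof -
    obtain y' where "y' \<in> M" "measure_proj M y' = measure_proj M y"
      using M.measure_proj_surj[OF M.measure_proj_range] by blast
    then show ?thesis using G[of y] G[of y'] eq[of y'] F(2) measure_proj_transfer_map(1)[OF \<psi>] by simp
  qed
  obtain LF where LF: "LF-lipschitz_on {0..a} F" using F(1) by (auto simp: Lip0_def)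
  define BK where "BK = {x\<in>K. \<not> ((primitive K f has_real_derivative f x) (at x) \<and> (measure_proj K has_real_derivative 1) (at x))}"
  have "negligible BK"
  proof -
    have "AE x in lebesgue. \<not> (x \<in> K \<and> \<not> ((primitive K f has_real_derivative f x) (at x) \<and>
        (measure_proj K has_real_derivative 1) (at x)))"
      using K.primitive_has_derivative[OF f] K.measure_proj_has_derivative
      by eventually_elim auto
    then show ?thesis unfolding BK_def by (rule negligible_of_AE)
  qed
  define BF where "BF = {t. 0 < t \<and> t < a \<and> \<not> (\<exists>d. (F has_real_derivative d) (at t))}"
  define B\<psi> where "B\<psi> = {t. 0 < t \<and> t < m \<and> \<not> (\<exists>d. (\<psi> has_real_derivative d) (at t))}"
  define S where "S = ({0, a} \<union> BF \<union> measure_proj K ` BK) \<inter> {0..a}"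
  have "negligible (measure_proj K ` BK)"
    using \<open>negligible BK\<close>
    by (rule negligible_lipschitz_image[OF lipschitz_on_subset[OF K.measure_proj_lipschitz subset_UNIV]])
  moreover have "negligible BF" "negligible B\<psi>"
    unfolding BF_def B\<psi>_def
    by (rule lipschitz_AE_differentiable[OF LF a_nonneg], rule lipschitz_AE_differentiable[OF L(1) m_nonneg])
  ultimately have "negligible S" 
    unfolding S_def by (intro negligible_subset[OF _ Int_lower1] negligible_Un negligible_insert[THEN iffD2] negligible_empty)
  then have "negligible (\<theta> ` S)"
    by (rule negligible_lipschitz_image[OF lipschitz_on_subset[OF L(2)], rotated]) (simp add: S_def)
  with \<open>negligible B\<psi>\<close> have "negligible ({0, m} \<union> B\<psi> \<union> \<theta> ` S)" by (intro negligible_Un) auto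
  from M.negligible_measure_proj_vimage[OF this]
  have "AE y in lebesgue. y \<notin> {y\<in>M. measure_proj M y \<in> {0, m} \<union> B\<psi> \<union> \<theta> ` S}"
    unfolding negligible_iff_null_sets by (rule AE_not_in)
  then have "AE y in lebesgue. y \<in> M \<longrightarrow> g y = \<epsilon> * f (transfer_map M K \<psi> y) * deriv \<psi> (measure_proj M y)"
    using M.primitive_has_derivative[OF g] M.measure_proj_has_derivative
  proof eventually_elim
    case (elim y)
    show ?case
    proof
      assume y: "y \<in> M"
      define t where "t = measure_proj M y"
      define u where "u = \<psi> t"
      define x where "x = left_selector K u"
      have t: "t \<in> {0..m}" using M.measure_proj_range by (simp add: t_def)
      have t': "t \<notin> {0, m}" "t \<notin> B\<psi>" "t \<notin> \<theta> ` S" using elim(1) y by (auto simp: t_def)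
      have u: "u \<in> {0..a}" using range(1)[OF t] by (simp add: u_def)
      have "u \<notin> S" using t'(3) inv[OF t] by (metis imageI u_def)
      then have u': "u \<notin> {0, a}" "u \<notin> BF" "u \<notin> measure_proj K ` BK" using u by (auto simp: S_def)
      have x: "x \<in> K" "measure_proj K x = u"
        using K.left_selector_in[OF u] K.measure_proj_left_selector[OF u] by (auto simp: x_def)
      have tx: "transfer_map M K \<psi> y = x" by (simp add: transfer_map_def x_def u_def t_def)
      obtain d where d: "(F has_real_derivative d) (at u)"
        using u u'(1,2) by (auto simp: BF_def)
      obtain e where e: "(\<psi> has_real_derivative e) (at t)"
        using t t'(1,2) by (auto simp: B\<psi>_def)
      have "x \<notin> BK" using u'(3) x(2) by blast
      then have fx: "(primitive K f has_real_derivative f x) (at x)" "(measure_proj K has_real_derivative 1) (at x)"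
        using x(1) by (auto simp: BK_def)
      have "((\<lambda>x. F (measure_proj K x)) has_real_derivative d * 1) (at x)"
        using d fx(2) x(2) by (intro DERIV_chain2) auto
      moreover have "(\<lambda>x. F (measure_proj K x)) = primitive K f" using F(2) by auto
      ultimately have "(primitive K f has_real_derivative d) (at x)" by simp
      with fx(1) have "d = f x" by (intro DERIV_unique)
      have My: "(measure_proj M has_real_derivative 1) (at y)" "(primitive M g has_real_derivative g y) (at y)"
        using elim(2,3) y by auto
      have "((\<lambda>y. \<psi> (measure_proj M y)) has_real_derivative e * 1) (at y)"
        using e My(1) by (intro DERIV_chain2) (auto simp: t_def)
      then have "((\<lambda>y. F (\<psi> (measure_proj M y))) has_real_derivative d * (e * 1)) (at y)"
        using d by (intro DERIV_chain2) (auto simp: u_def t_def)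
      then have "((\<lambda>y. \<epsilon> * F (\<psi> (measure_proj M y))) has_real_derivative \<epsilon> * (d * (e * 1))) (at y)"
        by (rule DERIV_cmult)
      moreover have "(\<lambda>y. \<epsilon> * F (\<psi> (measure_proj M y))) = primitive M g" using prim by auto
      ultimately have "g y = \<epsilon> * (d * e)" using My(2) DERIV_unique by fastforce
      moreover have "deriv \<psi> t = e" using e by (rule DERIV_imp_deriv)
      ultimately show "g y = \<epsilon> * f (transfer_map M K \<psi> y) * deriv \<psi> (measure_proj M y)"
        using \<open>d = f x\<close> tx by (simp add: t_def)
    qed
  qed
  then show ?thesis by (simp add: AE_restrict_space_iff)
qed

end

section \<open>Linear maps between the spaces of classes\<close>

locale Linf_linear_map = positive_compact_pair K M for K M +
  fixes T :: "(real \<Rightarrow> real) set \<Rightarrow> (real \<Rightarrow> real) set"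
  assumes linear: "Linf_linear K M T"
begin

lemma T_Linf: "\<Phi> \<in> Linf K \<Longrightarrow> T \<Phi> \<in> Linf M"
  using linear by (auto simp: Linf_linear_def)

lemma T_add: "\<Phi> \<in> Linf K \<Longrightarrow> \<Psi> \<in> Linf K \<Longrightarrow> T (Linf_add K \<Phi> \<Psi>) = Linf_add M (T \<Phi>) (T \<Psi>)"
  using linear by (auto simp: Linf_linear_def)

lemma T_scale: "\<Phi> \<in> Linf K \<Longrightarrow> T (Linf_scale K c \<Phi>) = Linf_scale M c (T \<Phi>)"
  using linear by (auto simp: Linf_linear_def)

text \<open>
  The map \<open>T\<close>, seen on the Lipschitz factors of the primitives.
\<close>

definition primitives_related :: "(real \<Rightarrow> real) \<Rightarrow> (real \<Rightarrow> real) \<Rightarrow> bool" where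
  "primitives_related F G \<longleftrightarrow> F \<in> Lip0 a \<and> G \<in> Lip0 m \<and>
     (\<exists>\<Phi>\<in>Linf K. (\<forall>x. Linf_primitive K \<Phi> x = F (measure_proj K x)) \<and>
        (\<forall>y. Linf_primitive M (T \<Phi>) y = G (measure_proj M y)))"

lemma primitives_relatedI:
  assumes "\<Phi> \<in> Linf K" "F \<in> Lip0 a" "G \<in> Lip0 m"
    "\<And>x. Linf_primitive K \<Phi> x = F (measure_proj K x)"
    "\<And>y. Linf_primitive M (T \<Phi>) y = G (measure_proj M y)"
  shows "primitives_related F G"
  using assms by (auto simp: primitives_related_def)

lemma primitives_relatedE:
  assumes "primitives_related F G"
  obtains \<Phi> where "\<Phi> \<in> Linf K" "F \<in> Lip0 a" "G \<in> Lip0 m"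
    "\<And>x. Linf_primitive K \<Phi> x = F (measure_proj K x)"
    "\<And>y. Linf_primitive M (T \<Phi>) y = G (measure_proj M y)"
  using assms by (auto simp: primitives_related_def)

lemma sup_isometry_primitives:
  assumes iso: "surjective_isometry K M T"
  shows "sup_isometry a m primitives_related"
proof
  show "0 < a" "0 < m" using K.positive M.positive by auto
  show "F \<in> Lip0 a" "G \<in> Lip0 m" if "primitives_related F G" for F G
    using that by (auto simp: primitives_related_def)
  show "primitives_related (\<lambda>x. F x + F' x) (\<lambda>x. G x + G' x)"
    if FG: "primitives_related F G" and FG': "primitives_related F' G'" for F G F' G'
  proof (rule primitives_relatedE[OF FG], rule primitives_relatedE[OF FG'])
    fix \<Phi> \<Phi>'
    assume 1: "\<Phi> \<in> Linf K" "F \<in> Lip0 a" "G \<in> Lip0 m" "\<And>x. Linf_primitive K \<Phi> x = F (measure_proj K x)"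
      "\<And>y. Linf_primitive M (T \<Phi>) y = G (measure_proj M y)"
    assume 2: "\<Phi>' \<in> Linf K" "F' \<in> Lip0 a" "G' \<in> Lip0 m" "\<And>x. Linf_primitive K \<Phi>' x = F' (measure_proj K x)"
      "\<And>y. Linf_primitive M (T \<Phi>') y = G' (measure_proj M y)"
    show ?thesis
    proof (rule primitives_relatedI)
      show "Linf_add K \<Phi> \<Phi>' \<in> Linf K" by (rule K.Linf_add_primitive(1)[OF 1(1) 2(1)])
      show "Linf_primitive K (Linf_add K \<Phi> \<Phi>') x = F (measure_proj K x) + F' (measure_proj K x)" for x
        by (simp only: K.Linf_add_primitive(2)[OF 1(1) 2(1)] 1(4) 2(4))
      show "Linf_primitive M (T (Linf_add K \<Phi> \<Phi>')) y = G (measure_proj M y) + G' (measure_proj M y)" for y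
        by (simp only: T_add[OF 1(1) 2(1)] M.Linf_add_primitive(2)[OF T_Linf[OF 1(1)] T_Linf[OF 2(1)]] 1(5) 2(5))
    qed (intro Lip0_add 1 2)+
  qed
  show "primitives_related (\<lambda>x. c * F x) (\<lambda>x. c * G x)" if FG: "primitives_related F G" for F G c
  proof (rule primitives_relatedE[OF FG])
    fix \<Phi>
    assume 1: "\<Phi> \<in> Linf K" "F \<in> Lip0 a" "G \<in> Lip0 m" "\<And>x. Linf_primitive K \<Phi> x = F (measure_proj K x)"
      "\<And>y. Linf_primitive M (T \<Phi>) y = G (measure_proj M y)"
    show ?thesis
    proof (rule primitives_relatedI)
      show "Linf_scale K c \<Phi> \<in> Linf K" by (rule K.Linf_scale_primitive(1)[OF 1(1)])
      show "Linf_primitive K (Linf_scale K c \<Phi>) x = c * F (measure_proj K x)" for x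
        by (simp only: K.Linf_scale_primitive(2)[OF 1(1)] 1(4))
      show "Linf_primitive M (T (Linf_scale K c \<Phi>)) y = c * G (measure_proj M y)" for y
        by (simp only: T_scale[OF 1(1)] M.Linf_scale_primitive(2)[OF T_Linf[OF 1(1)]] 1(5))
    qed (intro Lip0_scale 1)+
  qed
  show "\<exists>G. primitives_related F G" if F: "F \<in> Lip0 a" for F
  proof -
    obtain \<Phi> where \<Phi>: "\<Phi> \<in> Linf K" "\<And>x. Linf_primitive K \<Phi> x = F (measure_proj K x)"
      by (rule K.Linf_surj[OF F]) blast
    obtain G where "G \<in> Lip0 m" "\<And>y. Linf_primitive M (T \<Phi>) y = G (measure_proj M y)"
      by (rule M.Linf_factors[OF T_Linf[OF \<Phi>(1)]]) blast
    with \<Phi> F show ?thesis by (blast intro: primitives_relatedI)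
  qed
  show "\<exists>F. primitives_related F G" if G: "G \<in> Lip0 m" for G
  proof -
    obtain \<Psi> where \<Psi>: "\<Psi> \<in> Linf M" "\<And>y. Linf_primitive M \<Psi> y = G (measure_proj M y)"
      by (rule M.Linf_surj[OF G]) blast
    obtain \<Phi> where \<Phi>: "\<Phi> \<in> Linf K" "T \<Phi> = \<Psi>"
      using iso \<Psi>(1) unfolding surjective_isometry_def by (metis imageE)
    obtain F where "F \<in> Lip0 a" "\<And>x. Linf_primitive K \<Phi> x = F (measure_proj K x)"
      by (rule K.Linf_factors[OF \<Phi>(1)]) blast
    with \<Phi> \<Psi> G show ?thesis by (blast intro: primitives_relatedI)
  qed
  show "(\<forall>t\<in>{0..a}. \<bar>F t\<bar> \<le> C) \<longleftrightarrow> (\<forall>t\<in>{0..m}. \<bar>G t\<bar> \<le> C)"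
    if FG: "primitives_related F G" for F G C
  proof (rule primitives_relatedE[OF FG])
    fix \<Phi>
    assume 1: "\<Phi> \<in> Linf K" "F \<in> Lip0 a" "G \<in> Lip0 m" "\<And>x. Linf_primitive K \<Phi> x = F (measure_proj K x)"
      "\<And>y. Linf_primitive M (T \<Phi>) y = G (measure_proj M y)"
    have "alexiewicz_norm M (T \<Phi>) = alexiewicz_norm K \<Phi>"
      using iso 1(1) by (simp add: surjective_isometry_def)
    moreover have "alexiewicz_norm K \<Phi> \<le> C \<longleftrightarrow> (\<forall>t\<in>{0..a}. \<bar>F t\<bar> \<le> C)"
      by (rule K.alexiewicz_norm_le_iff[OF 1(4) 1(2)])
    moreover have "alexiewicz_norm M (T \<Phi>) \<le> C \<longleftrightarrow> (\<forall>t\<in>{0..m}. \<bar>G t\<bar> \<le> C)"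
      by (rule M.alexiewicz_norm_le_iff[OF 1(5) 1(3)])
    ultimately show ?thesis by simp
  qed
qed

lemma primitive_formula_of_isometry:
  assumes iso: "surjective_isometry K M T"
  shows "\<exists>\<epsilon>\<in>{1, -1}. \<exists>\<psi>. increasing_lipeomorphism {0..m} {0..a} \<psi> \<and> primitive_formula K M T \<epsilon> \<psi>"
proof -
  interpret S: sup_isometry a m primitives_related by (rule sup_isometry_primitives[OF iso])
  obtain \<epsilon> \<psi> where \<epsilon>: "\<epsilon> \<in> {1, -1}" and \<psi>: "increasing_lipeomorphism {0..m} {0..a} \<psi>"
    and rep: "\<And>F G t. primitives_related F G \<Longrightarrow> t \<in> {0..m} \<Longrightarrow> G t = \<epsilon> * F (\<psi> t)"
    by (rule S.banach_stone) blast
  have "Linf_primitive M (T \<Phi>) y = \<epsilon> * Linf_primitive K \<Phi> (transfer_map M K \<psi> y)" if \<Phi>: "\<Phi> \<in> Linf K" for \<Phi> y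
  proof -
    obtain F where F: "F \<in> Lip0 a" "\<And>x. Linf_primitive K \<Phi> x = F (measure_proj K x)"
      by (rule K.Linf_factors[OF \<Phi>]) blast
    obtain G where G: "G \<in> Lip0 m" "\<And>y. Linf_primitive M (T \<Phi>) y = G (measure_proj M y)"
      by (rule M.Linf_factors[OF T_Linf[OF \<Phi>]]) blast
    have "G (measure_proj M y) = \<epsilon> * F (\<psi> (measure_proj M y))"
      using primitives_relatedI[OF \<Phi> F(1) G(1) F(2) G(2)] M.measure_proj_range by (rule rep)
    then show ?thesis by (simp only: F(2) G(2) measure_proj_transfer_map(1)[OF \<psi>])
  qed
  then have "primitive_formula K M T \<epsilon> \<psi>" by (simp add: primitive_formula_def)
  with \<epsilon> \<psi> show ?thesis by blast
qed

text \<open>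
  The norm is preserved because \<open>\<psi>\<close> is onto. For surjectivity, the class with primitive factor \<open>G\<close>
  is the image of the one with factor \<open>\<epsilon> * (G \<circ> \<theta>)\<close>, where \<open>\<theta>\<close> is the inverse of \<open>\<psi>\<close>.
\<close>

lemma isometry_of_primitive_formula:
  assumes \<epsilon>: "\<epsilon> \<in> {1, -1}" and \<psi>: "increasing_lipeomorphism {0..m} {0..a} \<psi>"
    and formula: "primitive_formula K M T \<epsilon> \<psi>"
  shows "surjective_isometry K M T"
proof -
  obtain \<theta> L L' where L: "L-lipschitz_on {0..m} \<psi>" "L'-lipschitz_on {0..a} \<theta>"
    and range: "\<And>t. t \<in> {0..m} \<Longrightarrow> \<psi> t \<in> {0..a}" "\<And>u. u \<in> {0..a} \<Longrightarrow> \<theta> u \<in> {0..m}"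
    and inv: "\<And>t. t \<in> {0..m} \<Longrightarrow> \<theta> (\<psi> t) = t" "\<And>u. u \<in> {0..a} \<Longrightarrow> \<psi> (\<theta> u) = u"
    and zero: "\<theta> 0 = 0"
    by (rule increasing_lipeomorphismE[OF \<psi> m_nonneg a_nonneg]) blast
  have form: "Linf_primitive M (T \<Phi>) y = \<epsilon> * F (\<psi> (measure_proj M y))"
    if "\<Phi> \<in> Linf K" "\<And>x. Linf_primitive K \<Phi> x = F (measure_proj K x)" "y \<in> M" for \<Phi> F y
    using formula that measure_proj_transfer_map(1)[OF \<psi>] by (simp add: primitive_formula_def)
  have "alexiewicz_norm M (T \<Phi>) = alexiewicz_norm K \<Phi>" if \<Phi>: "\<Phi> \<in> Linf K" for \<Phi>
  proof -
    obtain F where F: "\<And>x. Linf_primitive K \<Phi> x = F (measure_proj K x)"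
      by (rule K.Linf_factors[OF \<Phi>]) blast
    have im: "\<psi> ` {0..m} = {0..a}"
    proof
      show "\<psi> ` {0..m} \<subseteq> {0..a}" using range(1) by (rule image_subsetI)
      show "{0..a} \<subseteq> \<psi> ` {0..m}"
      proof
        fix u assume u: "u \<in> {0..a}"
        have "\<psi> (\<theta> u) \<in> \<psi> ` {0..m}" using range(2)[OF u] by (rule imageI)
        then show "u \<in> \<psi> ` {0..m}" by (simp only: inv(2)[OF u])
      qed
    qed
    have "alexiewicz_norm M (T \<Phi>) = (SUP t\<in>{0..m}. \<bar>\<epsilon> * F (\<psi> t)\<bar>)"
      by (rule M.alexiewicz_norm_eq) (rule form[OF \<Phi> F])
    also have "\<dots> = (SUP t\<in>{0..m}. \<bar>F (\<psi> t)\<bar>)" using \<epsilon> by (auto simp: abs_mult)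
    also have "\<dots> = (SUP u\<in>\<psi> ` {0..m}. \<bar>F u\<bar>)" by (simp only: image_image)
    also have "\<dots> = alexiewicz_norm K \<Phi>"
      unfolding im by (rule K.alexiewicz_norm_eq[symmetric]) (rule F)
    finally show ?thesis .
  qed
  moreover have "T ` Linf K = Linf M"
  proof
    show "T ` Linf K \<subseteq> Linf M" using T_Linf by (rule image_subsetI)
    show "Linf M \<subseteq> T ` Linf K"
    proof
      fix \<Psi> assume \<Psi>: "\<Psi> \<in> Linf M"
      obtain G where G: "G \<in> Lip0 m" "\<And>y. Linf_primitive M \<Psi> y = G (measure_proj M y)"
        by (rule M.Linf_factors[OF \<Psi>]) blast
      have "(\<lambda>u. \<epsilon> * G (\<theta> u)) \<in> Lip0 a"
        using G(1) L(2) range(2) zero by (rule Lip0_compose)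
      then obtain \<Phi> where \<Phi>: "\<Phi> \<in> Linf K" "\<And>x. Linf_primitive K \<Phi> x = \<epsilon> * G (\<theta> (measure_proj K x))"
        by (rule K.Linf_surj) blast
      have "T \<Phi> = \<Psi>"
      proof (rule M.Linf_inject[OF T_Linf[OF \<Phi>(1)] \<Psi>])
        fix y assume "y \<in> M"
        from form[of \<Phi> "\<lambda>u. \<epsilon> * G (\<theta> u)", OF \<Phi> this]
        have "Linf_primitive M (T \<Phi>) y = \<epsilon> * (\<epsilon> * G (\<theta> (\<psi> (measure_proj M y))))" .
        then show "Linf_primitive M (T \<Phi>) y = Linf_primitive M \<Psi> y"
          using \<epsilon> by (auto simp: inv(1)[OF M.measure_proj_range] G(2))
      qed
      with \<Phi>(1) show "\<Psi> \<in> T ` Linf K" by blast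
    qed
  qed
  ultimately show ?thesis by (simp add: surjective_isometry_def)
qed

text \<open>
  From right to left, the function \<open>\<epsilon> * (F \<circ> \<psi>)\<close> is the primitive factor of some \<open>g'\<close>. By the
  chain rule \<open>g'\<close> satisfies the pointwise formula that \<open>g\<close> is assumed to satisfy, so the two agree
  almost everywhere and have the same primitive.
\<close>

lemma primitive_formula_iff_pointwise_formula:
  assumes \<psi>: "increasing_lipeomorphism {0..m} {0..a} \<psi>"
  shows "primitive_formula K M T \<epsilon> \<psi> \<longleftrightarrow> pointwise_formula K M T \<epsilon> \<psi>"
proof
  assume formula: "primitive_formula K M T \<epsilon> \<psi>"
  show "pointwise_formula K M T \<epsilon> \<psi>"
    unfolding pointwise_formula_def
  proof (intro ballI)
    fix \<Phi> f g assume \<Phi>: "\<Phi> \<in> Linf K" and f: "f \<in> \<Phi>" and g: "g \<in> T \<Phi>"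
    show "AE y in lebesgue_on M. g y = \<epsilon> * f (transfer_map M K \<psi> y) * deriv \<psi> (measure_proj M y)"
    proof (rule pointwise_of_primitive[OF \<psi> K.Linf_memberD(1)[OF \<Phi> f] M.Linf_memberD(1)[OF T_Linf[OF \<Phi>] g]])
      fix y assume "y \<in> M"
      with formula \<Phi> have "Linf_primitive M (T \<Phi>) y = \<epsilon> * Linf_primitive K \<Phi> (transfer_map M K \<psi> y)"
        by (simp add: primitive_formula_def)
      then show "primitive M g y = \<epsilon> * primitive K f (transfer_map M K \<psi> y)"
        by (simp only: K.Linf_primitive_member[OF \<Phi> f] M.Linf_primitive_member[OF T_Linf[OF \<Phi>] g])
    qed
  qed
next
  assume formula: "pointwise_formula K M T \<epsilon> \<psi>"
  obtain \<theta> L L' where L: "L-lipschitz_on {0..m} \<psi>" "\<psi> 0 = 0"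
    and range: "\<And>t. t \<in> {0..m} \<Longrightarrow> \<psi> t \<in> {0..a}"
    by (rule increasing_lipeomorphismE[OF \<psi> m_nonneg a_nonneg]) blast
  show "primitive_formula K M T \<epsilon> \<psi>"
    unfolding primitive_formula_def
  proof (intro ballI)
    fix \<Phi> y assume \<Phi>: "\<Phi> \<in> Linf K" and "y \<in> M"
    obtain f where f: "f \<in> ess_bounded K" "f \<in> \<Phi>"
      using K.Linf_representative[OF \<Phi>] by blast
    obtain g where g: "g \<in> ess_bounded M" "g \<in> T \<Phi>"
      using M.Linf_representative[OF T_Linf[OF \<Phi>]] by blast
    obtain F where F: "F \<in> Lip0 a" "\<And>x. primitive K f x = F (measure_proj K x)"
      by (rule K.primitive_factors[OF f(1)]) blast
    have "(\<lambda>t. \<epsilon> * F (\<psi> t)) \<in> Lip0 m"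
      using F(1) L(1) range L(2) by (rule Lip0_compose)
    then obtain g' where g': "g' \<in> ess_bounded M" "\<And>y. primitive M g' y = \<epsilon> * F (\<psi> (measure_proj M y))"
      by (rule M.primitive_surj) blast
    have eq: "primitive M g' y = \<epsilon> * primitive K f (transfer_map M K \<psi> y)" for y
      by (simp only: g'(2) F(2) measure_proj_transfer_map(1)[OF \<psi>])
    have "AE y in lebesgue_on M. g y = \<epsilon> * f (transfer_map M K \<psi> y) * deriv \<psi> (measure_proj M y)"
      using formula \<Phi> f(2) g(2) by (simp add: pointwise_formula_def)
    with pointwise_of_primitive[OF \<psi> f(1) g'(1) eq]
    have "AE y in lebesgue_on M. g y = g' y" by eventually_elim simp
    with g(1) g'(1) have "(g, g') \<in> ae_eq M" by (simp add: ae_eq_def)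
    from primitive_cong[OF M.compact this, of y] eq[of y]
    show "Linf_primitive M (T \<Phi>) y = \<epsilon> * Linf_primitive K \<Phi> (transfer_map M K \<psi> y)"
      by (simp only: K.Linf_primitive_member[OF \<Phi> f(2)] M.Linf_primitive_member[OF T_Linf[OF \<Phi>] g(2)])
  qed
qed

end

theorem theorem1p1:
  fixes M K :: "real set" and T :: "(real \<Rightarrow> real) set \<Rightarrow> (real \<Rightarrow> real) set"
  assumes "compact M" and "compact K"
    and "0 < measure lebesgue M" and "0 < measure lebesgue K"
    and "Linf_linear K M T"
  shows "(surjective_isometry K M T \<longleftrightarrow>
       (\<exists>\<epsilon>\<in>{1, -1::real}. \<exists>\<psi>.
          increasing_lipeomorphism {0..measure lebesgue M} {0..measure lebesgue K} \<psi> \<and>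
          primitive_formula K M T \<epsilon> \<psi>)) \<and>
    (\<forall>\<epsilon>\<in>{1, -1::real}. \<forall>\<psi>.
       increasing_lipeomorphism {0..measure lebesgue M} {0..measure lebesgue K} \<psi> \<longrightarrow>
       (primitive_formula K M T \<epsilon> \<psi> \<longleftrightarrow> pointwise_formula K M T \<epsilon> \<psi>))"
proof -
  interpret Linf_linear_map K M T
    using assms by unfold_locales
  show ?thesis
    using primitive_formula_of_isometry isometry_of_primitive_formula primitive_formula_iff_pointwise_formula
    by blast
qed

end
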